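(* Let $(X,\mu)$ be a bounded valency coarse median algebra, and let $(X,d_\mu,\mu)$ be the corresponding coarse median space, where $d_\mu$ is the induced metric. Then the rank of the coarse median algebra $(X,\mu)$ agrees with the rank of the coarse median space $(X,d_\mu,\mu)$; that is, for every natural number $n$, the coarse median algebra $(X,\mu)$ has rank at most $n$ if and only if the coarse median space $(X,d_\mu,\mu)$ has rank at most $n$.
   Context: Here $\mathbb R^+=[0,\infty)$ and $\sharp$ denotes cardinality. For a set $X$ with $\mu:X^3\to X$ (a ternary algebra), $[a,b]=\{\mu(a,x,b)\mid x\in X\}$. Coarse median algebra: a ternary algebra $(X,\mu)$ with all intervals finite such that (M1) $\mu(a,a,b)=a$; (M2) $\mu$ is invariant under all permutations of its arguments; (M3)' there is $K\ge0$ such that for all $a,b,c,d,e\in X$ the interval $[\mu(a,b,\mu(c,d,e)),\mu(\mu(a,b,c),\mu(a,b,d),e)]$ has cardinality at most $K$. Bounded valency: there is $\phi:\mathbb R^+\to\mathbb R^+$ with $\sharp\{y\in X\mid\sharp[x,y]\le R\}\le\phi(R)$ for all $x\in X$ and all $R$. Induced metric: $d_\mu(a,b)=\min\{\sum_{i=1}^m(\sharp[x_{i-1},x_i]-1):a=x_0,\ldots,x_m=b,\ x_i\in X,\ m\in\mathbb N\}$. For a bounded valency coarse median algebra, $(X,d_\mu,\mu)$ is a bounded geometry coarse median space (balls of given radius have uniformly bounded cardinality). Rank of a coarse median algebra: $(X,\mu)$ has rank at most $n$ if there is a non-decreasing function $\varphi:\mathbb R^+\to\mathbb R^+$ such that for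 any $x_1,\ldots,x_{n+1}$ and $p,q\in X$, $\min\{\sharp[p,\mu(x_i,p,q)]:i=1,\ldots,n+1\}\le\varphi(\max\{\sharp[p,\mu(x_i,x_j,p)]:i\ne j\})$ (a maximum over the empty set is read as $0$). Coarse median space: $(X,d,\mu)$ with $d$ a metric and $\mu$ satisfying (M1), (M2), (C1) there is an affine $\rho:[0,\infty)\to[0,\infty)$ with $d(\mu(a,b,c),\mu(a',b,c))\le\rho(d(a,a'))$, and (C2) there is $\kappa_4>0$ with $d(\mu(\mu(a,b,c),b,d),\mu(a,b,\mu(c,b,d)))\le\kappa_4$. It is known that such a space satisfies: (B2) there is $h:\mathbb N\to\mathbb R^+$ such that for every $A\subseteq X$ with $1\le|A|\le p<\infty$ there are a finite median algebra $(\Pi,\mu_\Pi)$ and maps $\pi:A\to\Pi$, $\lambda:\Pi\to X$ with $d(\lambda(\mu_\Pi(x,y,z)),\mu(\lambda(x),\lambda(y),\lambda(z)))\le h(p)$ for all $x,y,z\in\Pi$ and $d(a,\lambda\pi(a))\le h(p)$ for all $a\in A$. A median algebra is a set with a ternary operation satisfying (M1), (M2) and $\mu(a,b,\mu(c,d,e))=\mu(\mu(a,b,c),\mu(a,b,d),e)$; its rank is the supremum of the $m$ for which it contains a subalgebra isomorphic to $\{0,1\}^m$ with coordinatewise majority vote. Rank of a coarse median space: rank at most $n$ means (B2) can be satisfied (for some $h$) with all $\Pi$ of rank at most $n$. It is a known theorem (Niblo–Wright–Zhang) that this is equivalent to: for every $\lambda>0$ there is $C$ such that for any $a,b\in X$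 and $e_1,\ldots,e_{n+1}\in[a,b]$ with $d(\mu(e_i,a,e_j),a)\le\lambda$ for all $i\ne j$, some $e_i$ satisfies $d(e_i,a)\le C$. *)

theory Defs
  imports Complex_Main "HOL-Library.FuncSet" "HOL-Library.Extended_Nat"
begin

section \<open>Coarse median algebras\<close>

text \<open>A ternary algebra is a type carrying a ternary operation.\<close>

definition med_interval :: "('a \<Rightarrow> 'a \<Rightarrow> 'a \<Rightarrow> 'a) \<Rightarrow> 'a \<Rightarrow> 'a \<Rightarrow> 'a set" where
  "med_interval \<mu> a b = {\<mu> a x b | x. True}"

definition coarse_median_algebra :: "('a \<Rightarrow> 'a \<Rightarrow> 'a \<Rightarrow> 'a) \<Rightarrow> bool" where
  "coarse_median_algebra \<mu> \<longleftrightarrow>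
     (\<forall>a b. finite (med_interval \<mu> a b)) \<and>
     (\<forall>a b. \<mu> a a b = a) \<and>
     (\<forall>a b c. \<mu> a c b = \<mu> a b c \<and> \<mu> b a c = \<mu> a b c \<and> \<mu> b c a = \<mu> a b c \<and>
              \<mu> c a b = \<mu> a b c \<and> \<mu> c b a = \<mu> a b c) \<and>
     (\<exists>K::real. K \<ge> 0 \<and>
        (\<forall>a b c d e.
           real (card (med_interval \<mu> (\<mu> a b (\<mu> c d e)) (\<mu> (\<mu> a b c) (\<mu> a b d) e))) \<le> K))"

text \<open>Finiteness is stated explicitly because \<open>card\<close> is \<open>0\<close> on infinite sets.\<close>

definition bounded_valency :: "('a \<Rightarrow> 'a \<Rightarrow> 'a \<Rightarrow> 'a) \<Rightarrow> bool" where
  "bounded_valency \<mu> \<longleftrightarrow>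
     (\<exists>\<phi>::real \<Rightarrow> real. (\<forall>t\<ge>0. \<phi> t \<ge> 0) \<and>
        (\<forall>x. \<forall>R\<ge>0.
           finite {y. real (card (med_interval \<mu> x y)) \<le> R} \<and>
           real (card {y. real (card (med_interval \<mu> x y)) \<le> R}) \<le> \<phi> R))"

text \<open>
  The sums range over the natural numbers, so the minimum is a \<open>LEAST\<close>; the chain \<open>a, b\<close> shows
  that it is attained. The truncated subtraction is harmless, as finite intervals of a
  coarse median algebra are nonempty.
\<close>

definition induced_metric :: "('a \<Rightarrow> 'a \<Rightarrow> 'a \<Rightarrow> 'a) \<Rightarrow> 'a \<Rightarrow> 'a \<Rightarrow> real" where
  "induced_metric \<mu> a b =
     real (LEAST s. \<exists>(m::nat) x. x 0 = a \<and> x m = b \<and>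
                      s = (\<Sum>i=1..m. card (med_interval \<mu> (x (i - 1)) (x i)) - 1))"

text \<open>
  Inserting \<open>0\<close> changes the maximum only when there are no pairs \<open>i \<noteq> j\<close>, that is, for \<open>n = 0\<close>,
  where the maximum over the empty set is read as \<open>0\<close>.
\<close>

definition algebra_rank_at_most :: "('a \<Rightarrow> 'a \<Rightarrow> 'a \<Rightarrow> 'a) \<Rightarrow> nat \<Rightarrow> bool" where
  "algebra_rank_at_most \<mu> n \<longleftrightarrow>
     (\<exists>\<phi>::real \<Rightarrow> real. (\<forall>t\<ge>0. \<phi> t \<ge> 0) \<and> mono_on {0..} \<phi> \<and>
        (\<forall>(x :: nat \<Rightarrow> 'a) p q.
           real (Min {card (med_interval \<mu> p (\<mu> (x i) p q)) | i. i \<in> {1..n+1}})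
           \<le> \<phi> (real (Max (insert 0
                 {card (med_interval \<mu> p (\<mu> (x i) (x j) p)) | i j.
                    i \<in> {1..n+1} \<and> j \<in> {1..n+1} \<and> i \<noteq> j})))))"

section \<open>Median algebras and their rank\<close>

text \<open>Median algebras have an explicit carrier, as they are quantified over existentially below.\<close>

definition median_algebra :: "'b set \<Rightarrow> ('b \<Rightarrow> 'b \<Rightarrow> 'b \<Rightarrow> 'b) \<Rightarrow> bool" where
  "median_algebra P m \<longleftrightarrow>
     (\<forall>a\<in>P. \<forall>b\<in>P. \<forall>c\<in>P. m a b c \<in> P) \<and>
     (\<forall>a\<in>P. \<forall>b\<in>P. m a a b = a) \<and>
     (\<forall>a\<in>P. \<forall>b\<in>P. \<forall>c\<in>P. m a c b = m a b c \<and> m b a c = m a b c \<and> m b c a = m a b c \<and>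
                             m c a b = m a b c \<and> m c b a = m a b c) \<and>
     (\<forall>a\<in>P. \<forall>b\<in>P. \<forall>c\<in>P. \<forall>d\<in>P. \<forall>e\<in>P. m a b (m c d e) = m (m a b c) (m a b d) e)"

text \<open>The cube \<open>{0,1}\<^sup>k\<close>, with \<open>bool\<close> in place of \<open>{0,1}\<close>.\<close>

definition cube :: "nat \<Rightarrow> (nat \<Rightarrow> bool) set" where
  "cube k = {..<k} \<rightarrow>\<^sub>E UNIV"

definition cube_majority ::
    "nat \<Rightarrow> (nat \<Rightarrow> bool) \<Rightarrow> (nat \<Rightarrow> bool) \<Rightarrow> (nat \<Rightarrow> bool) \<Rightarrow> (nat \<Rightarrow> bool)" where
  "cube_majority k x y z = (\<lambda>i\<in>{..<k}. (x i \<and> y i) \<or> (y i \<and> z i) \<or> (z i \<and> x i))"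

definition contains_cube :: "'b set \<Rightarrow> ('b \<Rightarrow> 'b \<Rightarrow> 'b \<Rightarrow> 'b) \<Rightarrow> nat \<Rightarrow> bool" where
  "contains_cube P m k \<longleftrightarrow>
     (\<exists>S\<subseteq>P. (\<forall>a\<in>S. \<forall>b\<in>S. \<forall>c\<in>S. m a b c \<in> S) \<and>
        (\<exists>f. bij_betw f (cube k) S \<and>
           (\<forall>x\<in>cube k. \<forall>y\<in>cube k. \<forall>z\<in>cube k.
              f (cube_majority k x y z) = m (f x) (f y) (f z))))"

definition median_rank :: "'b set \<Rightarrow> ('b \<Rightarrow> 'b \<Rightarrow> 'b \<Rightarrow> 'b) \<Rightarrow> enat" where
  "median_rank P m = (SUP k \<in> {k. contains_cube P m k}. enat k)"

section \<open>Rank of a coarse median space\<close>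

text \<open>
  Condition (B2), with all the approximating finite median algebras of rank at most \<open>n\<close>. Up to
  isomorphism, the carrier of a finite median algebra is a finite set of natural numbers. The
  map called \<open>\<lambda>\<close> in (B2) is \<open>\<sigma>\<close> here.
\<close>

definition space_rank_at_most ::
    "('a \<Rightarrow> 'a \<Rightarrow> real) \<Rightarrow> ('a \<Rightarrow> 'a \<Rightarrow> 'a \<Rightarrow> 'a) \<Rightarrow> nat \<Rightarrow> bool" where
  "space_rank_at_most d \<mu> n \<longleftrightarrow>
     (\<exists>h::nat \<Rightarrow> real. (\<forall>p. h p \<ge> 0) \<and>
        (\<forall>p A. finite A \<and> 1 \<le> card A \<and> card A \<le> p \<longrightarrow>
           (\<exists>(P :: nat set) m (\<pi> :: 'a \<Rightarrow> nat) (\<sigma> :: nat \<Rightarrow> 'a).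
              finite P \<and> median_algebra P m \<and> median_rank P m \<le> enat n \<and> \<pi> \<in> A \<rightarrow> P \<and>
              (\<forall>x\<in>P. \<forall>y\<in>P. \<forall>z\<in>P. d (\<sigma> (m x y z)) (\<mu> (\<sigma> x) (\<sigma> y) (\<sigma> z)) \<le> h p) \<and>
              (\<forall>a\<in>A. d a (\<sigma> (\<pi> a)) \<le> h p))))"

end

theory Submission
  imports Defs
begin

text \<open>
  The two ranks are compared through finite median algebras. For the integer-valued metric
  \<open>d\<close> induced by \<open>\<mu>\<close>, the operation \<open>\<mu>\<close> is Lipschitz, and the size of the interval from \<open>a\<close> to \<open>b\<close>
  and the distance \<open>d a b\<close> bound each other uniformly; this is where bounded valency enters.
  So both rank conditions become statements about uniform bounds on \<open>d\<close>.

  In a median algebra, distinct points are separated by a halfspace, that is, by a homomorphism to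
  the median algebra \<open>{0,1}\<close> (\<open>halfspace_separation\<close>). Hence every identity can be checked with
  Boolean values, and a finitely generated median algebra is finite
  (\<open>finite_if_finitely_generated\<close>).

  If the space has rank at most \<open>n\<close>, approximate the points \<open>p, q, x\<^sub>1, \<dots>, x\<^sub>n\<^sub>+\<^sub>1\<close> by points
  \<open>p', q', Y\<^sub>i\<close> of a finite median algebra of rank at most \<open>n\<close>. Project the medians of
  \<open>Y\<^sub>i, Y\<^sub>j, p'\<close> for \<open>i \<noteq> j\<close> to the interval from \<open>p'\<close> to \<open>q'\<close>, let \<open>F\<close> be their join in this
  interval, and \<open>E\<^sub>i\<close> the median of \<open>Y\<^sub>i, F, q'\<close>. Any two of the \<open>E\<^sub>i\<close> meet in \<open>F\<close>, so they would
  span an \<open>(n+1)\<close>-cube if all of them differed from \<open>F\<close> (\<open>contains_cube_if_disjoint\<close>). So some \<open>E\<^sub>i\<close>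
  equals \<open>F\<close>. If all the medians of \<open>x\<^sub>i, x\<^sub>j, p\<close> are close to \<open>p\<close>, then so is the image of \<open>F\<close>,
  and therefore the median of \<open>x\<^sub>i, p, q\<close>.

  Conversely, suppose that the algebra has rank at most \<open>n\<close>, but that for some number \<open>p\<close> no
  error bound works for all sets of at most \<open>p\<close> points. Choose for every natural number \<open>h\<close> a set \<open>A h\<close> of at most
  \<open>p\<close> points that has no approximation with error \<open>h\<close>. Enumerating these sets gives \<open>p\<close> sequences of
  points; consider the sequences generated by them under \<open>\<mu>\<close>, and identify two of them if their
  distance is bounded on an infinite set \<open>I\<close> of indices. As \<open>\<mu>\<close> satisfies the median identity up to
  a bounded error, the quotient is a median algebra. It is generated by \<open>p\<close> elements, so it is
  finite, and \<open>I\<close> can be chosen such that the number of classes is minimal. An \<open>(n+1)\<close>-cube in the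
  quotient would give sequences to which the rank condition applies at each index of \<open>I\<close>; by the
  pigeonhole principle, one edge of the cube is then bounded on an infinite subset of \<open>I\<close>, on which
  there are fewer classes (\<open>no_large_cube_if_fewest_classes\<close>). So the quotient has rank at most \<open>n\<close>.
  Evaluating representatives at an index \<open>h\<close> of \<open>I\<close> approximates \<open>A h\<close>, with an error that does not
  depend on \<open>h\<close>. For large \<open>h\<close>, this contradicts the choice of \<open>A h\<close>.
\<close>

section \<open>Halfspaces of median algebras\<close>

locale median_alg =
  fixes P :: "'b set" and m :: "'b \<Rightarrow> 'b \<Rightarrow> 'b \<Rightarrow> 'b"
  assumes median_algebra: "median_algebra P m"
begin

lemma closed [simp, intro]: "\<lbrakk>a \<in> P; b \<in> P; c \<in> P\<rbrakk> \<Longrightarrow> m a b c \<in> P"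
  using median_algebra unfolding median_algebra_def by blast

lemma majority [simp]:
  assumes "a \<in> P" "b \<in> P"
  shows "m a a b = a" "m a b a = a" "m b a a = a"
  using median_algebra assms unfolding median_algebra_def by metis+

lemma swap23: "\<lbrakk>a \<in> P; b \<in> P; c \<in> P\<rbrakk> \<Longrightarrow> m a c b = m a b c"
  using median_algebra unfolding median_algebra_def by metis

lemma swap12: "\<lbrakk>a \<in> P; b \<in> P; c \<in> P\<rbrakk> \<Longrightarrow> m b a c = m a b c"
  using median_algebra unfolding median_algebra_def by metis

lemmas perm = swap23 swap12

lemma distrib:
  "\<lbrakk>a \<in> P; b \<in> P; c \<in> P; d \<in> P; e \<in> P\<rbrakk> \<Longrightarrow> m a b (m c d e) = m (m a b c) (m a b d) e"
  using median_algebra unfolding median_algebra_def by blast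

text \<open>
  For a fixed base point \<open>b\<close>, the operation \<open>m u v b\<close> of \<open>u\<close> and \<open>v\<close> is the meet of a semilattice with
  least element \<open>b\<close>. The geometric arguments below are computations in such semilattices.
\<close>

lemma meet_assoc:
  assumes "u \<in> P" "v \<in> P" "w \<in> P" "b \<in> P"
  shows "m (m u v b) w b = m u (m v w b) b"
proof -
  have "m w b (m v b u) = m (m w b v) (m w b b) u"
    using assms by (intro distrib) auto
  then show ?thesis
    using assms by (simp add: perm)
qed

definition convex :: "'b set \<Rightarrow> bool" where
  "convex C \<longleftrightarrow> C \<subseteq> P \<and> (\<forall>x\<in>C. \<forall>y\<in>C. \<forall>z\<in>P. m x y z \<in> C)"

lemma convexD: "\<lbrakk>convex C; x \<in> C; y \<in> C; z \<in> P\<rbrakk> \<Longrightarrow> m x y z \<in> C"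
  unfolding convex_def by blast

text \<open>
  The union of the intervals from \<open>x\<close> to the points of \<open>C\<close>: in a median algebra, \<open>m c x z = z\<close> says
  that \<open>z\<close> lies between \<open>c\<close> and \<open>x\<close>.
\<close>

definition join :: "'b set \<Rightarrow> 'b \<Rightarrow> 'b set" where
  "join C x = {z \<in> P. \<exists>c\<in>C. m c x z = z}"

text \<open>
  With base point \<open>w\<close>, the meet of \<open>c\<close> and \<open>x\<close> lies below both ends of the interval from \<open>c\<close> to \<open>x\<close>,
  and hence below every point \<open>z\<close> of it.
\<close>

lemma meet_below_interval:
  assumes "c \<in> P" "x \<in> P" "z \<in> P" "w \<in> P" "m c x z = z"
  shows "m (m c x w) z w = m c x w"
proof -
  let ?p = "m c x w"
  have "m ?p w (m c x z) = m (m ?p w c) (m ?p w x) z"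
    using assms by (intro distrib) auto
  moreover have "m ?p w c = ?p"
  proof -
    have "m (m x c w) c w = m x (m c c w) w"
      using assms by (intro meet_assoc) auto
    then show ?thesis using assms by (simp add: perm)
  qed
  moreover have "m ?p w x = ?p"
  proof -
    have "m (m c x w) x w = m c (m x x w) w"
      using assms by (intro meet_assoc) auto
    then show ?thesis using assms by (simp add: perm)
  qed
  ultimately show ?thesis
    using assms by (simp add: perm)
qed

text \<open>
  Let \<open>w\<close> be between the points \<open>z1\<close> and \<open>z2\<close> of the join, which lie on intervals from \<open>c1\<close> and \<open>c2\<close>
  to \<open>x\<close>. With base point \<open>w\<close>, the meet of \<open>c1\<close>, \<open>c2\<close> and \<open>x\<close> is below \<open>z1\<close> and \<open>z2\<close>, whose meet is the
  least element \<open>w\<close>. So \<open>w\<close> is between \<open>x\<close> and the meet of \<open>c1\<close> and \<open>c2\<close>, which is in \<open>C\<close> by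
  convexity.
\<close>

lemma convex_join:
  assumes C: "convex C" and x: "x \<in> P"
  shows "convex (join C x)"
  unfolding convex_def
proof (intro conjI ballI)
  show "join C x \<subseteq> P" by (auto simp: join_def)
next
  fix z1 z2 t
  assume "z1 \<in> join C x" "z2 \<in> join C x" and t: "t \<in> P"
  then obtain c1 c2 where c: "c1 \<in> C" "c2 \<in> C" and z: "z1 \<in> P" "z2 \<in> P"
    and eq: "m c1 x z1 = z1" "m c2 x z2 = z2"
    by (auto simp: join_def)
  define w where "w = m z1 z2 t"
  have cP: "c1 \<in> P" "c2 \<in> P" using c C by (auto simp: convex_def)
  have w: "w \<in> P" using z t by (simp add: w_def)
  have zw: "m z1 z2 w = w"
  proof -
    have "m z1 z2 (m z1 z2 t) = m (m z1 z2 z1) (m z1 z2 z2) t"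
      using z t by (intro distrib) auto
    then show ?thesis using z t by (simp add: w_def)
  qed
  define p1 where "p1 = m c1 x w"
  define p2 where "p2 = m c2 x w"
  have pP: "p1 \<in> P" "p2 \<in> P" using cP x w by (auto simp: p1_def p2_def)
  have p: "m p1 z1 w = p1" "m p2 z2 w = p2"
    unfolding p1_def p2_def using meet_below_interval cP x z w eq by auto
  \<comment> \<open>Meets are taken with base point \<open>w\<close>, which is then the least element.\<close>
  have "m (m c1 c2 w) x w = m p1 p2 w"
  proof -
    have "m p1 p2 w = m c1 (m x p2 w) w"
      unfolding p1_def using cP x w pP by (intro meet_assoc) auto
    also have "m x p2 w = m (m x x w) c2 w"
      unfolding p2_def using meet_assoc[of x x c2 w] cP x w by (simp add: perm)
    also have "m c1 (m (m x x w) c2 w) w = m (m c1 c2 w) x w"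
      using meet_assoc[of c1 c2 x w] cP x w by (simp add: perm)
    finally show ?thesis by simp
  qed
  also have "\<dots> = m (m p1 p2 w) (m z1 z2 w) w"
  proof -
    have "m (m p1 p2 w) (m z1 z2 w) w = m (m (m p1 p2 w) z1 w) z2 w"
      using meet_assoc[of "m p1 p2 w" z1 z2 w] pP z w by simp
    also have "m (m p1 p2 w) z1 w = m p1 p2 w"
      using meet_assoc[of p2 p1 z1 w] p pP z w by (simp add: perm)
    also have "m (m p1 p2 w) z2 w = m p1 p2 w"
      using meet_assoc[of p1 p2 z2 w] p pP z w by (simp add: perm)
    finally show ?thesis by simp
  qed
  also have "\<dots> = w" using zw pP w by simp
  finally have "m (m c1 c2 w) x w = w" .
  moreover have "m c1 c2 w \<in> C" using convexD[OF C c w] .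
  ultimately show "m z1 z2 t \<in> join C x"
    using w by (auto simp: join_def w_def)
qed

text \<open>
  The preimage of \<open>1\<close> under a homomorphism to \<open>{0,1}\<close>. Equivalently, \<open>H\<close> and its complement meet
  \<open>P\<close> in convex sets; the form chosen here lets the simplifier evaluate medians.
\<close>

definition halfspace :: "'b set \<Rightarrow> bool" where
  "halfspace H \<longleftrightarrow> (\<forall>x\<in>P. \<forall>y\<in>P. \<forall>z\<in>P.
     m x y z \<in> H \<longleftrightarrow> x \<in> H \<and> y \<in> H \<or> y \<in> H \<and> z \<in> H \<or> z \<in> H \<and> x \<in> H)"

lemma halfspace_iff:
  "\<lbrakk>halfspace H; x \<in> P; y \<in> P; z \<in> P\<rbrakk> \<Longrightarrow>
    m x y z \<in> H \<longleftrightarrow> x \<in> H \<and> y \<in> H \<or> y \<in> H \<and> z \<in> H \<or> z \<in> H \<and> x \<in> H"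
  unfolding halfspace_def by blast

text \<open>
  By Zorn's lemma there is a maximal convex set \<open>C\<close> that contains \<open>a\<close> but not \<open>b\<close>. Its complement is
  convex too: if \<open>x\<close> and \<open>y\<close> are outside \<open>C\<close>, then by maximality \<open>b\<close> lies on intervals from points
  \<open>c, d\<close> of \<open>C\<close> to \<open>x\<close> and to \<open>y\<close>, and if a point between \<open>x\<close> and \<open>y\<close> were in \<open>C\<close>, then \<open>b\<close> would
  be between that point and the median of \<open>c, d, b\<close>, and thus in \<open>C\<close>.
\<close>

lemma halfspace_separation:
  assumes a: "a \<in> P" and b: "b \<in> P" and ab: "a \<noteq> b"
  obtains H where "halfspace H" "a \<in> H" "b \<notin> H"
proof -
  define \<C> where "\<C> = {C. convex C \<and> a \<in> C \<and> b \<notin> C}"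
  have "{a} \<in> \<C>" using a ab by (auto simp: \<C>_def convex_def)
  moreover have "\<Union>K \<in> \<C>" if "K \<noteq> {}" "subset.chain \<C> K" for K
  proof -
    have K: "K \<subseteq> \<C>" "\<And>C D. \<lbrakk>C \<in> K; D \<in> K\<rbrakk> \<Longrightarrow> C \<subseteq> D \<or> D \<subseteq> C"
      using that(2) by (auto simp: subset_chain_def)
    have "m x y z \<in> \<Union>K" if xy: "x \<in> \<Union>K" "y \<in> \<Union>K" "z \<in> P" for x y z
    proof -
      obtain C D where "C \<in> K" "x \<in> C" "D \<in> K" "y \<in> D" using xy by blast
      then obtain B where "B \<in> K" "x \<in> B" "y \<in> B" using K(2)[of C D] by blast
      then show ?thesis using K(1) xy(3) by (auto simp: \<C>_def intro: convexD)
    qed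
    then have "convex (\<Union>K)" using K(1) by (auto simp: convex_def \<C>_def)
    then show ?thesis using K(1) that(1) by (auto simp: \<C>_def)
  qed
  ultimately have "\<exists>M\<in>\<C>. \<forall>X\<in>\<C>. M \<subseteq> X \<longrightarrow> X = M"
    by (intro subset_Zorn_nonempty) auto
  then obtain C where C: "convex C" "a \<in> C" "b \<notin> C"
    and max: "\<And>X. \<lbrakk>convex X; a \<in> X; b \<notin> X; C \<subseteq> X\<rbrakk> \<Longrightarrow> X = C"
    by (auto simp: \<C>_def)
  have CP: "C \<subseteq> P" using C(1) by (simp add: convex_def)
  have reach: "\<exists>c\<in>C. m c x b = b" if x: "x \<in> P" "x \<notin> C" for x
  proof -
    have "C \<subseteq> join C x" using CP x(1) by (force simp: join_def)
    moreover have "x \<in> join C x" using CP C(2) x(1) by (force simp: join_def)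
    ultimately have "b \<in> join C x"
      using max[of "join C x"] convex_join[OF C(1) x(1)] C(2) x(2) by blast
    then show ?thesis by (auto simp: join_def)
  qed
  have out: "m x y z \<notin> C" if xy: "x \<in> P" "y \<in> P" "z \<in> P" "x \<notin> C" "y \<notin> C" for x y z
  proof
    assume inC: "m x y z \<in> C"
    obtain c d where cd: "c \<in> C" "m c x b = b" "d \<in> C" "m d y b = b"
      using reach xy by metis
    have P: "c \<in> P" "d \<in> P" using cd CP by auto
    \<comment> \<open>with base point \<open>b\<close>, the meet of \<open>q\<close> with \<open>x\<close> and with \<open>y\<close> is \<open>b\<close>\<close>
    define q where "q = m c d b"
    have q: "q \<in> C" unfolding q_def using convexD[OF C(1)] cd b by blast
    then have qP: "q \<in> P" using CP by blast
    have "m q b (m x y z) = m (m q b x) (m q b y) z"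
      using qP b xy by (intro distrib) auto
    moreover have "m q b x = b"
      using meet_assoc[of d c x b] cd P b xy by (simp add: q_def perm)
    moreover have "m q b y = b"
      using meet_assoc[of c d y b] cd P b xy by (simp add: q_def perm)
    ultimately have "m q b (m x y z) = b" using xy b by simp
    moreover have "m q (m x y z) b \<in> C" using convexD[OF C(1) q inC b] .
    ultimately show False using C(3) qP b xy by (simp add: swap23)
  qed
  have "halfspace C"
    unfolding halfspace_def
  proof (intro ballI iffI)
    fix x y z assume P: "x \<in> P" "y \<in> P" "z \<in> P"
    {
      assume "m x y z \<in> C"
      then show "x \<in> C \<and> y \<in> C \<or> y \<in> C \<and> z \<in> C \<or> z \<in> C \<and> x \<in> C"
        using out[of x y z] out[of y z x] out[of z x y] P by (auto simp: perm)
    next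
      assume "x \<in> C \<and> y \<in> C \<or> y \<in> C \<and> z \<in> C \<or> z \<in> C \<and> x \<in> C"
      then show "m x y z \<in> C"
        using convexD[OF C(1), of x y z] convexD[OF C(1), of y z x] convexD[OF C(1), of z x y] P
        by (auto simp: perm)
    }
  qed
  then show ?thesis using that C by blast
qed

text \<open>
  This reduces identities in \<open>P\<close> to propositional ones, because \<open>halfspace_iff\<close> computes the
  membership of medians.
\<close>

lemma eq_by_halfspaces:
  assumes "a \<in> P" "b \<in> P" "\<And>H. halfspace H \<Longrightarrow> a \<in> H \<longleftrightarrow> b \<in> H"
  shows "a = b"
  using halfspace_separation assms by metis

end

inductive_set generated :: "('b \<Rightarrow> 'b \<Rightarrow> 'b \<Rightarrow> 'b) \<Rightarrow> 'b set \<Rightarrow> 'b set"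
  for m :: "'b \<Rightarrow> 'b \<Rightarrow> 'b \<Rightarrow> 'b" and G :: "'b set" where
  base: "g \<in> G \<Longrightarrow> g \<in> generated m G"
| step: "\<lbrakk>x \<in> generated m G; y \<in> generated m G; z \<in> generated m G\<rbrakk>
    \<Longrightarrow> m x y z \<in> generated m G"

text \<open>
  A halfspace is determined on \<open>P\<close> by its trace on \<open>G\<close>, and a point by the halfspaces that contain
  it. So a point is determined by a set of subsets of \<open>G\<close>.
\<close>

lemma (in median_alg) finite_if_finitely_generated:
  assumes P: "P = generated m G" and G: "finite G"
  shows "finite P"
proof -
  have trace: "x \<in> H \<longleftrightarrow> x \<in> H'"
    if "halfspace H" "halfspace H'" "H \<inter> G = H' \<inter> G" "x \<in> generated m G" for H H' x
    using that(4)
  proof induction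
    case (base g)
    then show ?case using that by blast
  next
    case (step x y z)
    then show ?case using that by (simp add: halfspace_iff P)
  qed
  define T where "T x = {H \<inter> G | H. halfspace H \<and> x \<in> H}" for x
  have "inj_on T P"
  proof (rule inj_onI, rule ccontr)
    fix x y assume xy: "x \<in> P" "y \<in> P" "T x = T y" "x \<noteq> y"
    then obtain H where H: "halfspace H" "x \<in> H" "y \<notin> H"
      using halfspace_separation by blast
    then have "H \<inter> G \<in> T y" using xy(3) by (auto simp: T_def)
    then obtain H' where "halfspace H'" "y \<in> H'" "H \<inter> G = H' \<inter> G" by (auto simp: T_def)
    then show False using trace[of H H' y] H xy P by auto
  qed
  moreover have "T ` P \<subseteq> Pow (Pow G)" by (auto simp: T_def)
  then have "finite (T ` P)" using G by (auto intro: finite_subset)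
  ultimately show ?thesis by (metis finite_imageD)
qed


section \<open>Cubes in a median algebra\<close>

context median_alg
begin

text \<open>
  The join of \<open>F\<close> and those \<open>E i\<close>, \<open>i < j\<close>, for which \<open>x i\<close> holds, inside the interval
  from \<open>F\<close> to \<open>Q\<close>, where \<open>m u v Q\<close> is the join of \<open>u\<close> and \<open>v\<close>.
\<close>

fun cube_point :: "(nat \<Rightarrow> 'b) \<Rightarrow> 'b \<Rightarrow> 'b \<Rightarrow> (nat \<Rightarrow> bool) \<Rightarrow> nat \<Rightarrow> 'b" where
  "cube_point E F Q x 0 = F"
| "cube_point E F Q x (Suc j) =
    (if x j then m (E j) (cube_point E F Q x j) Q else cube_point E F Q x j)"

text \<open>
  The joins of subfamilies of \<open>E\<close> form the cube. For a halfspace \<open>H\<close>, at most one \<open>E i\<close> is not on the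
  same side as \<open>F\<close>, since two such elements would put their meet \<open>F\<close> on their side. So whether a join
  is in \<open>H\<close> is constant, or given by one coordinate or by its negation, and hence compatible with
  majority votes.
\<close>

lemma contains_cube_if_disjoint:
  assumes P: "F \<in> P" "Q \<in> P" "\<And>i. i < k \<Longrightarrow> E i \<in> P"
    and interval: "\<And>i. i < k \<Longrightarrow> m (E i) F Q = E i"
    and disjoint: "\<And>i j. \<lbrakk>i < k; j < k; i \<noteq> j\<rbrakk> \<Longrightarrow> m (E i) (E j) F = F"
    and nontrivial: "\<And>i. i < k \<Longrightarrow> E i \<noteq> F"
  shows "contains_cube P m k"
proof -
  define f where "f x = cube_point E F Q x k" for x
  have pointP: "cube_point E F Q x j \<in> P" if "j \<le> k" for x j
    using that by (induction j) (auto simp: P)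
  then have fP: "f x \<in> P" for x by (simp add: f_def)
  have E_iff: "E i \<in> H \<longleftrightarrow> E i \<in> H \<and> F \<in> H \<or> F \<in> H \<and> Q \<in> H \<or> Q \<in> H \<and> E i \<in> H"
    if "halfspace H" "i < k" for H i
    using halfspace_iff[of H "E i" F Q] interval[of i] that P by auto
  have same: "cube_point E F Q x j \<in> H \<longleftrightarrow> F \<in> H"
    if "halfspace H" "F \<in> H \<longleftrightarrow> Q \<in> H" "j \<le> k" for H x j
    using that(3)
  proof (induction j)
    case (Suc j)
    then show ?case
      using that E_iff[of H j] by (auto simp: halfspace_iff P pointP)
  qed simp
  have up: "cube_point E F Q x j \<in> H \<longleftrightarrow> (\<exists>i<j. x i \<and> E i \<in> H)"
    if "halfspace H" "F \<notin> H" "Q \<in> H" "j \<le> k" for H x j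
    using that(4)
  proof (induction j)
    case (Suc j)
    then show ?case
      using that by (auto simp: halfspace_iff P pointP less_Suc_eq)
  qed (use that in simp)
  have down: "cube_point E F Q x j \<in> H \<longleftrightarrow> (\<forall>i<j. x i \<longrightarrow> E i \<in> H)"
    if "halfspace H" "F \<in> H" "Q \<notin> H" "j \<le> k" for H x j
    using that(4)
  proof (induction j)
    case (Suc j)
    then show ?case
      using that by (auto simp: halfspace_iff P pointP less_Suc_eq)
  qed (use that in simp)
  have others: "\<forall>j<k. j \<noteq> i \<longrightarrow> (E j \<in> H \<longleftrightarrow> F \<in> H)"
    if "halfspace H" "i < k" "E i \<in> H \<longleftrightarrow> F \<notin> H" for H i
  proof (intro allI impI)
    fix j assume "j < k" "j \<noteq> i"
    then show "E j \<in> H \<longleftrightarrow> F \<in> H"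
      using halfspace_iff[of H "E i" "E j" F] disjoint[of i j] that P by auto
  qed
  have coordinate: "(\<exists>c. \<forall>x. f x \<in> H \<longleftrightarrow> c) \<or>
      (\<exists>i<k. (\<forall>x. f x \<in> H \<longleftrightarrow> x i) \<or> (\<forall>x. f x \<in> H \<longleftrightarrow> \<not> x i))"
    if H: "halfspace H" for H
  proof (cases "\<exists>i<k. (F \<in> H \<longleftrightarrow> Q \<notin> H) \<and> (E i \<in> H \<longleftrightarrow> F \<notin> H)")
    case True
    then obtain i where i: "i < k" "F \<in> H \<longleftrightarrow> Q \<notin> H" "E i \<in> H \<longleftrightarrow> F \<notin> H" by blast
    show ?thesis
    proof (cases "F \<in> H")
      case True
      then have "f x \<in> H \<longleftrightarrow> \<not> x i" for x
        using down[OF H True _ order_refl, of x] True i others[OF H i(1,3)] unfolding f_def by blast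
      then show ?thesis using i by blast
    next
      case False
      then have "f x \<in> H \<longleftrightarrow> x i" for x
        using up[OF H False _ order_refl, of x] False i others[OF H i(1,3)] unfolding f_def by blast
      then show ?thesis using i by blast
    qed
  next
    case False
    then have "f x \<in> H \<longleftrightarrow> F \<in> H" for x
    proof (cases "F \<in> H \<longleftrightarrow> Q \<in> H")
      case True
      then show ?thesis using same[OF H True order_refl] by (simp add: f_def)
    next
      case neq: False
      show ?thesis
      proof (cases "F \<in> H")
        case True
        then show ?thesis using down[OF H True _ order_refl, of x] neq False unfolding f_def by blast
      next
        case F: False
        then show ?thesis using up[OF H F _ order_refl, of x] neq False unfolding f_def by blast
      qed
    qed
    then show ?thesis by blast
  qed
  have hom: "f (cube_majority k x y z) = m (f x) (f y) (f z)" for x y z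
  proof (rule eq_by_halfspaces)
    fix H assume H: "halfspace H"
    note iff = halfspace_iff[OF H fP fP fP]
    show "f (cube_majority k x y z) \<in> H \<longleftrightarrow> m (f x) (f y) (f z) \<in> H"
      using coordinate[OF H]
    proof (elim disjE exE conjE)
      fix c assume "\<forall>x. f x \<in> H \<longleftrightarrow> c"
      then show ?thesis unfolding iff by blast
    next
      fix i assume "i < k" "\<forall>x. f x \<in> H \<longleftrightarrow> x i"
      then show ?thesis unfolding iff by (simp add: cube_majority_def)
    next
      fix i assume "i < k" "\<forall>x. f x \<in> H \<longleftrightarrow> \<not> x i"
      then show ?thesis unfolding iff by (auto simp: cube_majority_def)
    qed
  qed (auto intro: fP)
  have inj: "inj_on f (cube k)"
  proof (rule inj_onI)
    fix x y assume xy: "x \<in> cube k" "y \<in> cube k" "f x = f y"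
    have "x i = y i" if i: "i < k" for i
    proof -
      obtain H where H: "halfspace H" "E i \<in> H" "F \<notin> H"
        using halfspace_separation[of "E i" F] nontrivial P i by blast
      then have Q: "Q \<in> H" using E_iff[of H i] i by blast
      have "f w \<in> H \<longleftrightarrow> w i" for w
        using up[OF H(1,3) Q order_refl, of w] H i others[OF H(1) i] unfolding f_def by blast
      then show ?thesis using xy(3) by metis
    qed
    then show "x = y"
      using xy(1,2) unfolding cube_def by (intro PiE_ext) auto
  qed
  have maj: "cube_majority k x y z \<in> cube k" for x y z
    by (auto simp: cube_majority_def cube_def)
  show ?thesis
    unfolding contains_cube_def
  proof (intro exI[of _ "f ` cube k"] conjI exI[of _ f])
    show "\<forall>a\<in>f ` cube k. \<forall>b\<in>f ` cube k. \<forall>c\<in>f ` cube k. m a b c \<in> f ` cube k"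
      by (auto simp: hom[symmetric] maj)
    show "bij_betw f (cube k) (f ` cube k)" using inj by (simp add: bij_betw_def)
  qed (use fP hom in blast)+
qed

lemma median_rank_le_iff: "median_rank P m \<le> enat n \<longleftrightarrow> (\<forall>k. contains_cube P m k \<longrightarrow> k \<le> n)"
  unfolding median_rank_def by (auto simp: SUP_le_iff)

end


section \<open>The induced metric\<close>

locale bounded_valency_algebra =
  fixes \<mu> :: "'a \<Rightarrow> 'a \<Rightarrow> 'a \<Rightarrow> 'a"
  assumes coarse_median: "coarse_median_algebra \<mu>"
    and bounded_valency: "bounded_valency \<mu>"
begin

lemma finite_interval [simp]: "finite (med_interval \<mu> a b)"
  using coarse_median unfolding coarse_median_algebra_def by blast

lemma mu_same [simp]: "\<mu> a a b = a"
  using coarse_median unfolding coarse_median_algebra_def by blast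

lemma mu_swap23: "\<mu> a c b = \<mu> a b c" and mu_swap12: "\<mu> b a c = \<mu> a b c"
  using coarse_median unfolding coarse_median_algebra_def by metis+

lemmas mu_perm = mu_swap23 mu_swap12

lemma mu_same' [simp]: "\<mu> a b a = a" "\<mu> b a a = a"
  using mu_same[of a b] by (simp_all only: mu_perm)

definition width :: "'a \<Rightarrow> 'a \<Rightarrow> nat" where
  "width a b = card (med_interval \<mu> a b)"

lemma width_commute: "width a b = width b a"
  unfolding width_def med_interval_def by (metis mu_perm)

lemma ends_in_interval: "a \<in> med_interval \<mu> a b" "b \<in> med_interval \<mu> a b"
  unfolding med_interval_def by (metis (mono_tags, lifting) mem_Collect_eq mu_same mu_same')+

lemma width_same [simp]: "width a a = 1"
  by (simp add: width_def med_interval_def)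

lemma width_ge_2:
  assumes "a \<noteq> b"
  shows "width a b \<ge> 2"
proof -
  have "card {a, b} \<le> width a b"
    unfolding width_def using ends_in_interval by (intro card_mono) auto
  then show ?thesis using assms by simp
qed

lemma coarse_distrib:
  obtains K where
    "\<And>a b c d e. width (\<mu> a b (\<mu> c d e)) (\<mu> (\<mu> a b c) (\<mu> a b d) e) \<le> K"
proof -
  obtain K :: real where
    "\<And>a b c d e. real (width (\<mu> a b (\<mu> c d e)) (\<mu> (\<mu> a b c) (\<mu> a b d) e)) \<le> K"
    using coarse_median unfolding coarse_median_algebra_def width_def by blast
  then show ?thesis
    by (intro that[of "nat \<lfloor>K\<rfloor>"]) (simp add: le_nat_floor)
qed

lemma bounded_neighbours:
  obtains V where "\<And>x. finite {y. width x y \<le> r} \<and> card {y. width x y \<le> r} \<le> V"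
proof -
  obtain \<phi> :: "real \<Rightarrow> real" where
    "\<And>x. finite {y. real (width x y) \<le> real r} \<and> real (card {y. real (width x y) \<le> real r}) \<le> \<phi> r"
    using bounded_valency unfolding bounded_valency_def width_def by (metis of_nat_0_le_iff)
  then show ?thesis
    by (intro that[of "nat \<lfloor>\<phi> r\<rfloor>"]) (simp add: le_nat_floor)
qed

text \<open>
  Chains with their total cost, in a form that allows induction on the last step.
\<close>

inductive walk :: "'a \<Rightarrow> 'a \<Rightarrow> nat \<Rightarrow> bool" for a where
  walk_refl: "walk a a 0"
| walk_step: "walk a b s \<Longrightarrow> walk a c (s + (width b c - 1))"

lemma walk_iff_chain:
  "walk a b s \<longleftrightarrow> (\<exists>(m::nat) x. x 0 = a \<and> x m = b \<and>
     s = (\<Sum>i=1..m. card (med_interval \<mu> (x (i - 1)) (x i)) - 1))"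
proof
  assume "walk a b s"
  then show "\<exists>(m::nat) x. x 0 = a \<and> x m = b \<and>
     s = (\<Sum>i=1..m. card (med_interval \<mu> (x (i - 1)) (x i)) - 1)"
  proof induction
    case walk_refl
    show ?case by (intro exI[of _ 0] exI[of _ "\<lambda>_. a"]) simp
  next
    case (walk_step b s c)
    then obtain m :: nat and x where x: "x 0 = a" "x m = b"
      "s = (\<Sum>i=1..m. card (med_interval \<mu> (x (i - 1)) (x i)) - 1)" by blast
    have "(\<Sum>i=1..m. card (med_interval \<mu> ((x(Suc m := c)) (i - 1)) ((x(Suc m := c)) i)) - 1) = s"
      unfolding x(3) by (intro sum.cong) auto
    then show ?case
      using x by (intro exI[of _ "Suc m"] exI[of _ "x(Suc m := c)"]) (simp add: width_def)
  qed
next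
  have "walk (x 0) (x m) (\<Sum>i=1..m. card (med_interval \<mu> (x (i - 1)) (x i)) - 1)"
    for m :: nat and x
  proof (induction m)
    case (Suc m)
    then show ?case using walk_step[OF Suc, of "x (Suc m)"] by (simp add: width_def)
  qed (simp add: walk_refl)
  moreover assume "\<exists>(m::nat) x. x 0 = a \<and> x m = b \<and>
     s = (\<Sum>i=1..m. card (med_interval \<mu> (x (i - 1)) (x i)) - 1)"
  ultimately show "walk a b s" by blast
qed

definition mdist :: "'a \<Rightarrow> 'a \<Rightarrow> nat" where
  "mdist a b = (LEAST s. walk a b s)"

lemma induced_metric_eq: "induced_metric \<mu> a b = real (mdist a b)"
  unfolding induced_metric_def mdist_def walk_iff_chain ..

lemma walk_edge: "walk a b (width a b - 1)"
  using walk_step[OF walk_refl, of a b] by simp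

lemma walk_mdist: "walk a b (mdist a b)"
  unfolding mdist_def using walk_edge by (rule LeastI)

lemma mdist_le: "walk a b s \<Longrightarrow> mdist a b \<le> s"
  unfolding mdist_def by (rule Least_le)

lemma mdist_le_width: "mdist a b \<le> width a b - 1"
  by (rule mdist_le[OF walk_edge])

lemma walk_trans:
  assumes "walk a b s" "walk b c t"
  shows "walk a c (s + t)"
  using assms(2)
proof induction
  case (walk_step c t e)
  then show ?case using walk.walk_step[of a c "s + t" e] by (simp add: add.assoc)
qed (use assms(1) in simp)

lemma mdist_triangle: "mdist a c \<le> mdist a b + mdist b c"
  using mdist_le[OF walk_trans[OF walk_mdist walk_mdist]] .

lemma mdist_same [simp]: "mdist a a = 0"
  using mdist_le[OF walk_refl] by simp

lemma walk_sym: "walk a b s \<Longrightarrow> walk b a s"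
proof (induction rule: walk.induct)
  case (walk_step b s c)
  then show ?case
    using walk_trans[OF walk_edge[of c b]] by (simp add: width_commute add.commute)
qed (rule walk_refl)

lemma mdist_commute: "mdist a b = mdist b a"
  by (meson mdist_le walk_mdist walk_sym le_antisym)

text \<open>
  Up to the error \<open>K\<close> of the median identity, the map that sends \<open>w\<close> to \<open>\<mu> b c w\<close> is a homomorphism, so
  each point of the interval between the images of \<open>a\<close> and \<open>a'\<close> has width at most \<open>K\<close> from the image of
  a point between \<open>a\<close> and \<open>a'\<close>. Bounded valency then bounds the number of such points.
\<close>

lemma coarse_lipschitz_width:
  obtains V where "\<And>a a' b c. width (\<mu> a b c) (\<mu> a' b c) \<le> V * width a a'"
proof -
  obtain K where
    K: "\<And>a b c d e. width (\<mu> a b (\<mu> c d e)) (\<mu> (\<mu> a b c) (\<mu> a b d) e) \<le> K"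
    using coarse_distrib by blast
  obtain V where V: "\<And>x. finite {y. width x y \<le> K} \<and> card {y. width x y \<le> K} \<le> V"
    using bounded_neighbours by blast
  show ?thesis
  proof (rule that)
    fix a a' b c
    let ?U = "\<Union>w\<in>med_interval \<mu> a a'. {z. width (\<mu> b c w) z \<le> K}"
    have "med_interval \<mu> (\<mu> a b c) (\<mu> a' b c) \<subseteq> ?U"
    proof
      fix z assume "z \<in> med_interval \<mu> (\<mu> a b c) (\<mu> a' b c)"
      then obtain e where z: "z = \<mu> (\<mu> a b c) e (\<mu> a' b c)" by (auto simp: med_interval_def)
      have "width (\<mu> b c (\<mu> a e a')) z \<le> K"
        using K[of b c a a' e] unfolding z by (simp add: mu_perm)
      moreover have "\<mu> a e a' \<in> med_interval \<mu> a a'" by (auto simp: med_interval_def)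
      ultimately show "z \<in> ?U" by blast
    qed
    then have "width (\<mu> a b c) (\<mu> a' b c) \<le> card ?U"
      unfolding width_def using V by (intro card_mono) (auto simp: width_def)
    also have "\<dots> \<le> (\<Sum>w\<in>med_interval \<mu> a a'. card {z. width (\<mu> b c w) z \<le> K})"
      by (rule card_UN_le) simp
    also have "\<dots> \<le> V * width a a'"
      using sum_bounded_above[of "med_interval \<mu> a a'" _ V] V
      by (simp add: width_def mult.commute)
    finally show "width (\<mu> a b c) (\<mu> a' b c) \<le> V * width a a'" .
  qed
qed

text \<open>
  The cost of a step is its width minus one, which is at least half of its width unless the step is
  trivial; hence the factor \<open>2\<close> in the Lipschitz constant.
\<close>

lemma coarse_lipschitz:
  obtains L where
    "\<And>a a' b b' c c'. mdist (\<mu> a b c) (\<mu> a' b' c') \<le> L * (mdist a a' + mdist b b' + mdist c c')"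
proof -
  obtain V where V: "\<And>a a' b c. width (\<mu> a b c) (\<mu> a' b c) \<le> V * width a a'"
    using coarse_lipschitz_width by blast
  let ?L = "2 * V"
  have edge: "width (\<mu> a b c) (\<mu> a' b c) - 1 \<le> ?L * (width a a' - 1)" for a a' b c
  proof (cases "a = a'")
    case False
    then have "width a a' \<le> 2 * (width a a' - 1)" using width_ge_2[of a a'] by simp
    then have "V * width a a' \<le> V * (2 * (width a a' - 1))" by (rule mult_left_mono) simp
    then have "V * width a a' \<le> ?L * (width a a' - 1)" by (simp only: mult_ac)
    then show ?thesis using V[of a b c a'] by linarith
  qed simp
  have "mdist (\<mu> a b c) (\<mu> a' b c) \<le> ?L * s" if "walk a a' s" for a a' b c s
    using that
  proof induction
    case (walk_step x s y)
    have "mdist (\<mu> a b c) (\<mu> y b c) \<le> mdist (\<mu> a b c) (\<mu> x b c) + mdist (\<mu> x b c) (\<mu> y b c)"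
      by (rule mdist_triangle)
    also have "\<dots> \<le> ?L * s + ?L * (width x y - 1)"
      using walk_step.IH mdist_le_width[of "\<mu> x b c" "\<mu> y b c"] edge[of x b c y] by linarith
    finally show ?case by (simp add: distrib_left)
  qed simp
  then have one: "mdist (\<mu> a b c) (\<mu> a' b c) \<le> ?L * mdist a a'" for a a' b c
    using walk_mdist by blast
  show ?thesis
  proof (rule that)
    fix a a' b b' c c'
    have "mdist (\<mu> a b c) (\<mu> a' b c) \<le> ?L * mdist a a'" by (rule one)
    moreover have "mdist (\<mu> a' b c) (\<mu> a' b' c) \<le> ?L * mdist b b'"
      using one[of b a' c b'] by (simp add: mu_perm)
    moreover have "mdist (\<mu> a' b' c) (\<mu> a' b' c') \<le> ?L * mdist c c'"
      using one[of c a' b' c'] by (simp add: mu_perm)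
    ultimately have "mdist (\<mu> a b c) (\<mu> a' b' c') \<le> ?L * mdist a a' + ?L * mdist b b' + ?L * mdist c c'"
      using mdist_triangle[of "\<mu> a b c" "\<mu> a' b' c'" "\<mu> a' b c"]
        mdist_triangle[of "\<mu> a' b c" "\<mu> a' b' c'" "\<mu> a' b' c"] by linarith
    then show "mdist (\<mu> a b c) (\<mu> a' b' c') \<le> ?L * (mdist a a' + mdist b b' + mdist c c')"
      by (simp add: distrib_left)
  qed
qed

lemma last_edge:
  assumes "walk a b s" "s \<le> Suc r"
  shows "\<exists>c. mdist a c \<le> r \<and> width c b \<le> r + 2"
  using assms
proof induction
  case walk_refl
  then show ?case by (intro exI[of _ a]) simp
next
  case (walk_step b s c)
  show ?case
  proof (cases "b = c")
    case True
    then show ?thesis using walk_step by simp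
  next
    case False
    then have "s \<le> r" "width b c \<le> r + 2" using walk_step.prems width_ge_2[of b c] by auto
    then show ?thesis using mdist_le[OF walk_step.hyps] by (intro exI[of _ b]) simp
  qed
qed

lemma walk_0: "walk a b s \<Longrightarrow> s = 0 \<Longrightarrow> b = a"
proof (induction rule: walk.induct)
  case (walk_step b s c)
  then show ?case using width_ge_2[of b c] by (cases "b = c") auto
qed simp

text \<open>
  A point at distance at most \<open>r + 1\<close> is joined to a point at distance at most \<open>r\<close> by a single step
  of bounded width: the last nontrivial step of a shortest chain. Each point has boundedly many
  such neighbours.
\<close>

lemma bounded_balls:
  obtains B where "\<And>a. finite {b. mdist a b \<le> r} \<and> card {b. mdist a b \<le> r} \<le> B"
proof -
  have "\<exists>B. \<forall>a. finite {b. mdist a b \<le> r} \<and> card {b. mdist a b \<le> r} \<le> B"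
  proof (induction r)
    case 0
    have "{b. mdist a b \<le> 0} = {a}" for a
      using walk_0[OF walk_mdist] by auto
    then show ?case by (intro exI[of _ 1]) simp
  next
    case (Suc r)
    then obtain B where B: "\<And>a. finite {b. mdist a b \<le> r} \<and> card {b. mdist a b \<le> r} \<le> B" by blast
    obtain V where V: "\<And>x. finite {y. width x y \<le> r + 2} \<and> card {y. width x y \<le> r + 2} \<le> V"
      using bounded_neighbours by blast
    have "finite {b. mdist a b \<le> Suc r} \<and> card {b. mdist a b \<le> Suc r} \<le> V * B" for a
    proof -
      let ?U = "\<Union>c\<in>{c. mdist a c \<le> r}. {b. width c b \<le> r + 2}"
      have sub: "{b. mdist a b \<le> Suc r} \<subseteq> ?U" using last_edge[OF walk_mdist] by blast
      have fin: "finite ?U" using B V by blast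
      have "card {b. mdist a b \<le> Suc r} \<le> card ?U" using sub fin by (intro card_mono)
      also have "\<dots> \<le> (\<Sum>c\<in>{c. mdist a c \<le> r}. card {b. width c b \<le> r + 2})"
        using B by (intro card_UN_le) simp
      also have "\<dots> \<le> card {c. mdist a c \<le> r} * V"
        using sum_bounded_above[of "{c. mdist a c \<le> r}" _ V] V by simp
      also have "\<dots> \<le> V * B" using B by (simp add: mult.commute)
      finally show ?thesis using sub fin finite_subset by blast
    qed
    then show ?case by blast
  qed
  then show ?thesis using that by blast
qed

text \<open>
  As \<open>\<mu>\<close> is Lipschitz, the interval from \<open>a\<close> to \<open>b\<close> lies in a ball around \<open>a = \<mu> a x a\<close> whose radius is
  proportional to \<open>mdist a b\<close>.
\<close>

lemma width_le_if_mdist_le: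
  obtains N where "\<And>a b. mdist a b \<le> r \<Longrightarrow> width a b \<le> N"
proof -
  obtain L where L:
    "\<And>a a' b b' c c'. mdist (\<mu> a b c) (\<mu> a' b' c') \<le> L * (mdist a a' + mdist b b' + mdist c c')"
    using coarse_lipschitz by blast
  obtain B where B: "\<And>a. finite {b. mdist a b \<le> L * r} \<and> card {b. mdist a b \<le> L * r} \<le> B"
    using bounded_balls by blast
  show ?thesis
  proof (rule that)
    fix a b assume ab: "mdist a b \<le> r"
    have "mdist a (\<mu> a x b) \<le> L * r" for x
    proof -
      have "mdist a (\<mu> a x b) \<le> L * mdist a b" using L[of a x a a x b] by simp
      also have "\<dots> \<le> L * r" using ab by simp
      finally show ?thesis .
    qed
    then have "med_interval \<mu> a b \<subseteq> {c. mdist a c \<le> L * r}" by (auto simp: med_interval_def)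
    then have "width a b \<le> card {c. mdist a c \<le> L * r}"
      unfolding width_def using B by (intro card_mono) auto
    then show "width a b \<le> B" using B le_trans by blast
  qed
qed

section \<open>Ranks in terms of uniform bounds\<close>

text \<open>
  A bound for each natural number is as good as a non-decreasing control function, since partial
  sums make the bounds monotone.
\<close>

lemma algebra_rank_iff:
  "algebra_rank_at_most \<mu> n \<longleftrightarrow>
     (\<forall>M. \<exists>N. \<forall>x p q.
        (\<forall>i\<in>{1..n+1}. \<forall>j\<in>{1..n+1}. i \<noteq> j \<longrightarrow> width p (\<mu> (x i) (x j) p) \<le> M) \<longrightarrow>
        (\<exists>i\<in>{1..n+1}. width p (\<mu> (x i) p q) \<le> N))"
    (is "_ \<longleftrightarrow> (\<forall>M. \<exists>N. \<forall>x p q. ?Max x p M \<longrightarrow> ?Min x p q N)")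
proof -
  define mn where "mn x p q = Min {width p (\<mu> (x i) p q) | i. i \<in> {1..n+1}}"
    for x :: "nat \<Rightarrow> 'a" and p q
  define mx where "mx x p = Max (insert 0 {width p (\<mu> (x i) (x j) p) | i j.
      i \<in> {1..n+1} \<and> j \<in> {1..n+1} \<and> i \<noteq> j})" for x :: "nat \<Rightarrow> 'a" and p
  have mn_le: "mn x p q \<le> N \<longleftrightarrow> ?Min x p q N" for x p q N
  proof -
    have eq: "{width p (\<mu> (x i) p q) | i. i \<in> {1..n+1}} = (\<lambda>i. width p (\<mu> (x i) p q)) ` {1..n+1}"
      by blast
    show ?thesis unfolding mn_def eq by (subst Min_le_iff) auto
  qed
  have mx_le: "mx x p \<le> M \<longleftrightarrow> ?Max x p M" for x p M
  proof -
    have eq: "{width p (\<mu> (x i) (x j) p) | i j. i \<in> {1..n+1} \<and> j \<in> {1..n+1} \<and> i \<noteq> j}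
      = (\<lambda>(i, j). width p (\<mu> (x i) (x j) p)) ` {(i, j) \<in> {1..n+1} \<times> {1..n+1}. i \<noteq> j}"
      by auto
    have "finite {(i, j) \<in> {1..n+1} \<times> {1..n+1}. i \<noteq> j}"
      by (rule finite_subset[of _ "{1..n+1} \<times> {1..n+1}"]) auto
    then show ?thesis unfolding mx_def eq by (subst Max_le_iff) auto
  qed
  have rank: "algebra_rank_at_most \<mu> n \<longleftrightarrow> (\<exists>\<phi>::real \<Rightarrow> real. (\<forall>t\<ge>0. \<phi> t \<ge> 0) \<and> mono_on {0..} \<phi> \<and>
      (\<forall>x p q. real (mn x p q) \<le> \<phi> (real (mx x p))))"
    unfolding algebra_rank_at_most_def mn_def mx_def width_def ..
  show ?thesis
  proof
    assume "algebra_rank_at_most \<mu> n"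
    then obtain \<phi> :: "real \<Rightarrow> real" where \<phi>: "mono_on {0..} \<phi>"
      "\<And>x p q. real (mn x p q) \<le> \<phi> (real (mx x p))"
      unfolding rank by blast
    have "mn x p q \<le> nat \<lfloor>\<phi> (real M)\<rfloor>" if "mx x p \<le> M" for x p q M
    proof -
      have "\<phi> (real (mx x p)) \<le> \<phi> (real M)" using that by (intro mono_onD[OF \<phi>(1)]) auto
      then show ?thesis using \<phi>(2)[of x p q] by (intro le_nat_floor) linarith
    qed
    then show "\<forall>M. \<exists>N. \<forall>x p q. ?Max x p M \<longrightarrow> ?Min x p q N"
      unfolding mn_le[symmetric] mx_le[symmetric] by blast
  next
    assume "\<forall>M. \<exists>N. \<forall>x p q. ?Max x p M \<longrightarrow> ?Min x p q N"
    then obtain N where N: "\<And>M x p q. mx x p \<le> M \<Longrightarrow> mn x p q \<le> N M"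
      unfolding mn_le[symmetric] mx_le[symmetric] by metis
    define \<phi> :: "real \<Rightarrow> real" where "\<phi> t = real (\<Sum>k\<le>nat \<lfloor>t\<rfloor>. N k)" for t
    have "mono_on {0..} \<phi>"
      unfolding \<phi>_def
      by (intro mono_onI of_nat_mono sum_mono2) (auto intro: nat_mono floor_mono order_trans)
    moreover have "real (mn x p q) \<le> \<phi> (real (mx x p))" for x p q
    proof -
      have "mn x p q \<le> N (mx x p)" using N by blast
      also have "\<dots> \<le> (\<Sum>k\<le>mx x p. N k)" by (rule member_le_sum) auto
      finally show ?thesis by (simp add: \<phi>_def del: of_nat_sum)
    qed
    ultimately show "algebra_rank_at_most \<mu> n"
      unfolding rank by (intro exI[of _ \<phi>]) (simp add: \<phi>_def del: of_nat_sum)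
  qed
qed

text \<open>
  As the induced metric is integer-valued, the error \<open>h\<close> can be taken to be a natural number.
\<close>

definition approximable :: "nat \<Rightarrow> nat \<Rightarrow> 'a set \<Rightarrow> bool" where
  "approximable n h A \<longleftrightarrow>
     (\<exists>(P :: nat set) m (\<pi> :: 'a \<Rightarrow> nat) (\<sigma> :: nat \<Rightarrow> 'a).
        finite P \<and> median_algebra P m \<and> median_rank P m \<le> enat n \<and> \<pi> \<in> A \<rightarrow> P \<and>
        (\<forall>x\<in>P. \<forall>y\<in>P. \<forall>z\<in>P. mdist (\<sigma> (m x y z)) (\<mu> (\<sigma> x) (\<sigma> y) (\<sigma> z)) \<le> h) \<and>
        (\<forall>a\<in>A. mdist a (\<sigma> (\<pi> a)) \<le> h))"

lemma space_rank_iff: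
  "space_rank_at_most (induced_metric \<mu>) \<mu> n \<longleftrightarrow>
     (\<forall>p. \<exists>h. \<forall>A. finite A \<and> 1 \<le> card A \<and> card A \<le> p \<longrightarrow> approximable n h A)"
proof -
  define ap where "ap r A \<longleftrightarrow> (\<exists>(P :: nat set) m (\<pi> :: 'a \<Rightarrow> nat) (\<sigma> :: nat \<Rightarrow> 'a).
      finite P \<and> median_algebra P m \<and> median_rank P m \<le> enat n \<and> \<pi> \<in> A \<rightarrow> P \<and>
      (\<forall>x\<in>P. \<forall>y\<in>P. \<forall>z\<in>P. real (mdist (\<sigma> (m x y z)) (\<mu> (\<sigma> x) (\<sigma> y) (\<sigma> z))) \<le> r) \<and>
      (\<forall>a\<in>A. real (mdist a (\<sigma> (\<pi> a))) \<le> r))" for r and A :: "'a set"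
  have rank: "space_rank_at_most (induced_metric \<mu>) \<mu> n \<longleftrightarrow> (\<exists>h. (\<forall>p::nat. h p \<ge> 0) \<and>
      (\<forall>p A. finite A \<and> 1 \<le> card A \<and> card A \<le> p \<longrightarrow> ap (h p) A))"
    unfolding space_rank_at_most_def induced_metric_eq ap_def ..
  have ap_nat: "ap (real h) A \<longleftrightarrow> approximable n h A" for h A
    unfolding ap_def approximable_def of_nat_le_iff ..
  have ap_real: "ap r A \<longleftrightarrow> ap (real (nat \<lfloor>r\<rfloor>)) A" if "r \<ge> 0" for r A
  proof -
    have "real k \<le> r \<longleftrightarrow> real k \<le> real (nat \<lfloor>r\<rfloor>)" for k
      by (meson le_nat_floor of_nat_floor of_nat_le_iff order_trans that)
    then show ?thesis unfolding ap_def by presburger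
  qed
  show ?thesis
  proof
    assume "space_rank_at_most (induced_metric \<mu>) \<mu> n"
    then obtain h where h: "\<forall>p::nat. h p \<ge> 0"
      "\<forall>p A. finite A \<and> 1 \<le> card A \<and> card A \<le> p \<longrightarrow> ap (h p) A"
      unfolding rank by (elim exE conjE)
    then have "approximable n (nat \<lfloor>h p\<rfloor>) A"
      if "finite A \<and> 1 \<le> card A \<and> card A \<le> p" for p A
      using that h ap_real[of "h p" A] unfolding ap_nat by blast
    then show "\<forall>p. \<exists>h. \<forall>A. finite A \<and> 1 \<le> card A \<and> card A \<le> p \<longrightarrow> approximable n h A"
      by blast
  next
    assume "\<forall>p. \<exists>h. \<forall>A. finite A \<and> 1 \<le> card A \<and> card A \<le> p \<longrightarrow> approximable n h A"
    then obtain h where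
      "\<And>p A. finite A \<and> 1 \<le> card A \<and> card A \<le> p \<Longrightarrow> approximable n (h p) A"
      by metis
    then show "space_rank_at_most (induced_metric \<mu>) \<mu> n"
      unfolding rank ap_nat[symmetric] by (intro exI[of _ "\<lambda>p. real (h p)"]) simp
  qed
qed


section \<open>The rank of the space bounds the rank of the algebra\<close>

text \<open>
  The elements \<open>E i\<close> below are pairwise disjoint over \<open>F\<close> exactly, although the points \<open>x i\<close> are so
  over \<open>p\<close> only up to a bounded error: \<open>F\<close> absorbs all the overlaps. The error made by passing from
  \<open>p\<close> to \<open>F\<close> depends only on \<open>M\<close> and the number of pairs.
\<close>

lemma space_rank_imp_algebra_rank:
  assumes "space_rank_at_most (induced_metric \<mu>) \<mu> n"
  shows "algebra_rank_at_most \<mu> n"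
  unfolding algebra_rank_iff
proof
  fix M
  let ?I = "{1..n+1}"
  obtain h where h: "\<And>A. finite A \<and> 1 \<le> card A \<and> card A \<le> n + 3 \<Longrightarrow> approximable n h A"
    using assms unfolding space_rank_iff by blast
  obtain L where L:
    "\<And>a a' b b' c c'. mdist (\<mu> a b c) (\<mu> a' b' c') \<le> L * (mdist a a' + mdist b b' + mdist c c')"
    using coarse_lipschitz by blast
  define ps where "ps = filter (\<lambda>(i, j). i \<noteq> j) (List.product [1..<n+2] [1..<n+2])"
  have ps: "set ps = {(i, j) \<in> ?I \<times> ?I. i \<noteq> j}"
    by (auto simp: ps_def)
  \<comment> \<open>\<open>B\<close> bounds the distance from \<open>p\<close> to the images of the overlaps of two points, \<open>D k\<close> the distance
    from \<open>p\<close> to the image of the join of \<open>k\<close> overlaps, and \<open>R\<close> the final distance\<close>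
  define B where "B = h + L * (h + h + h) + M"
  define D where "D k = ((\<lambda>D. h + L * (h + D + B)) ^^ k) h" for k
  define R where "R = h + L * (h + D (length ps) + h) + D (length ps)"
  obtain N where N: "\<And>a b. mdist a b \<le> R \<Longrightarrow> width a b \<le> N"
    using width_le_if_mdist_le by blast
  have "\<exists>i\<in>?I. width p (\<mu> (x i) p q) \<le> N"
    if small: "\<forall>i\<in>?I. \<forall>j\<in>?I. i \<noteq> j \<longrightarrow> width p (\<mu> (x i) (x j) p) \<le> M" for x p q
  proof -
    let ?A = "insert p (insert q (x ` ?I))"
    have "card ?A \<le> n + 3"
      using card_image_le[of ?I x] card_insert_if[of "x ` ?I" q] card_insert_if[of "insert q (x ` ?I)" p]
      by (simp split: if_splits)
    moreover have "1 \<le> card ?A" by (simp add: Suc_le_eq card_gt_0_iff)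
    ultimately have "approximable n h ?A" by (intro h) simp
    then obtain P :: "nat set" and m and \<pi> :: "'a \<Rightarrow> nat" and \<sigma> :: "nat \<Rightarrow> 'a" where
      malg: "median_algebra P m" and rank: "median_rank P m \<le> enat n" and \<pi>: "\<pi> \<in> ?A \<rightarrow> P"
      and hom: "\<And>x y z. \<lbrakk>x \<in> P; y \<in> P; z \<in> P\<rbrakk> \<Longrightarrow> mdist (\<sigma> (m x y z)) (\<mu> (\<sigma> x) (\<sigma> y) (\<sigma> z)) \<le> h"
      and near: "\<And>a. a \<in> ?A \<Longrightarrow> mdist a (\<sigma> (\<pi> a)) \<le> h"
      unfolding approximable_def by blast
    interpret median_alg P m using malg by unfold_locales
    have hom': "mdist (\<sigma> (m a b c)) (\<mu> a' b' c') \<le> h + L * (\<alpha> + \<beta> + \<gamma>)"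
      if "a \<in> P" "b \<in> P" "c \<in> P"
        "mdist (\<sigma> a) a' \<le> \<alpha>" "mdist (\<sigma> b) b' \<le> \<beta>" "mdist (\<sigma> c) c' \<le> \<gamma>"
      for a b c a' b' c' \<alpha> \<beta> \<gamma>
    proof -
      have "mdist (\<sigma> (m a b c)) (\<mu> a' b' c') \<le> mdist (\<sigma> (m a b c)) (\<mu> (\<sigma> a) (\<sigma> b) (\<sigma> c))
          + mdist (\<mu> (\<sigma> a) (\<sigma> b) (\<sigma> c)) (\<mu> a' b' c')"
        by (rule mdist_triangle)
      also have "\<dots> \<le> h + L * (mdist (\<sigma> a) a' + mdist (\<sigma> b) b' + mdist (\<sigma> c) c')"
        using hom that(1-3) L by (intro add_mono) auto
      also have "\<dots> \<le> h + L * (\<alpha> + \<beta> + \<gamma>)"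
        using that(4-6) by (intro add_left_mono mult_le_mono2 add_mono)
      finally show ?thesis .
    qed
    define Y where "Y i = \<pi> (x i)" for i
    define p' where "p' = \<pi> p"
    define q' where "q' = \<pi> q"
    have P: "p' \<in> P" "q' \<in> P" and Y: "\<And>i. i \<in> ?I \<Longrightarrow> Y i \<in> P"
      using \<pi> by (auto simp: p'_def q'_def Y_def)
    have near_p: "mdist (\<sigma> p') p \<le> h" and near_q: "mdist (\<sigma> q') q \<le> h"
      and near_Y: "\<And>i. i \<in> ?I \<Longrightarrow> mdist (\<sigma> (Y i)) (x i) \<le> h"
      using near by (simp_all add: p'_def q'_def Y_def mdist_commute)
    \<comment> \<open>\<open>G r p'\<close> is the join, in the interval from \<open>p'\<close> to \<open>q'\<close>, of the projected overlaps of the pairs in \<open>r\<close>\<close>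
    define G where "G = foldr (\<lambda>(i, j) F. m q' F (m (Y i) (Y j) p'))"
    have G_Nil: "G [] F = F" and G_Cons: "G ((i, j) # r) F = m q' (G r F) (m (Y i) (Y j) p')"
      for F i j r by (simp_all add: G_def)
    define F where "F = G ps p'"
    have GP: "G r p' \<in> P" if "set r \<subseteq> set ps" for r
      using that by (induction r) (auto simp: G_Nil G_Cons P Y ps)
    then have FP: "F \<in> P" by (simp add: F_def)
    have near_G: "mdist (\<sigma> (G r p')) p \<le> D (length r)" if "set r \<subseteq> set ps" for r
      using that
    proof (induction r)
      case Nil
      then show ?case using near_p by (simp add: G_Nil D_def)
    next
      case (Cons ij r)
      obtain i j where ij: "ij = (i, j)" by force
      have I: "i \<in> ?I" "j \<in> ?I" "i \<noteq> j" using Cons.prems by (auto simp: ps ij)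
      have "mdist (\<mu> (x i) (x j) p) p \<le> M"
        using small I mdist_le_width[of "\<mu> (x i) (x j) p" p] by (force simp: width_commute)
      moreover have "mdist (\<sigma> (m (Y i) (Y j) p')) (\<mu> (x i) (x j) p) \<le> h + L * (h + h + h)"
        using I by (intro hom' near_Y near_p Y P)
      ultimately have "mdist (\<sigma> (m (Y i) (Y j) p')) p \<le> B"
        using mdist_triangle[of "\<sigma> (m (Y i) (Y j) p')" p "\<mu> (x i) (x j) p"]
        unfolding B_def by linarith
      then have "mdist (\<sigma> (m q' (G r p') (m (Y i) (Y j) p'))) (\<mu> q p p) \<le> h + L * (h + D (length r) + B)"
        using Cons GP[of r] I by (intro hom' near_q) (auto simp: P Y)
      then show ?case by (simp add: ij G_Cons D_def)
    qed
    then have near_F: "mdist (\<sigma> F) p \<le> D (length ps)" by (simp add: F_def)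
    have F_iff: "G r p' \<in> H \<longleftrightarrow> p' \<in> H \<and> (q' \<in> H \<or> (\<forall>(i, j)\<in>set r. Y i \<in> H \<or> Y j \<in> H)) \<or>
        p' \<notin> H \<and> q' \<in> H \<and> (\<exists>(i, j)\<in>set r. Y i \<in> H \<and> Y j \<in> H)"
      if H: "halfspace H" and "set r \<subseteq> set ps" for H r
      using that(2)
    proof (induction r)
      case Nil
      then show ?case by (auto simp: G_Nil)
    next
      case (Cons ij r)
      obtain i j where ij: "ij = (i, j)" by force
      have I: "i \<in> ?I" "j \<in> ?I" "i \<noteq> j" using Cons.prems by (auto simp: ps ij)
      have "G (ij # r) p' \<in> H \<longleftrightarrow>
         q' \<in> H \<and> G r p' \<in> H \<or> G r p' \<in> H \<and> m (Y i) (Y j) p' \<in> H \<or> m (Y i) (Y j) p' \<in> H \<and> q' \<in> H"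
        unfolding ij G_Cons using Cons.prems I GP[of r] by (intro halfspace_iff[OF H]) (auto simp: P Y)
      moreover have "m (Y i) (Y j) p' \<in> H \<longleftrightarrow> Y i \<in> H \<and> Y j \<in> H \<or> Y j \<in> H \<and> p' \<in> H \<or> p' \<in> H \<and> Y i \<in> H"
        using I by (intro halfspace_iff[OF H]) (auto simp: P Y)
      moreover have "set r \<subseteq> set ps" using Cons.prems by simp
      note Cons.IH[OF this]
      ultimately show ?case unfolding ij by (cases "p' \<in> H"; cases "q' \<in> H") auto
    qed
    define E where "E i = m (Y i) F q'" for i
    have EP: "E i \<in> P" if "i \<in> ?I" for i using that by (simp add: E_def Y FP P)
    have E_interval: "m (E i) F q' = E i" if "i \<in> ?I" for i
      by (rule eq_by_halfspaces) (use that in \<open>auto simp: E_def halfspace_iff Y FP P\<close>)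
    have E_disjoint: "m (E i) (E j) F = F" if "i \<in> ?I" "j \<in> ?I" "i \<noteq> j" for i j
    proof (rule eq_by_halfspaces)
      fix H assume H: "halfspace H"
      have "(i, j) \<in> set ps" using that by (simp add: ps)
      then have "p' \<notin> H \<Longrightarrow> q' \<in> H \<Longrightarrow> Y i \<in> H \<Longrightarrow> Y j \<in> H \<Longrightarrow> F \<in> H"
        "p' \<in> H \<Longrightarrow> q' \<notin> H \<Longrightarrow> Y i \<notin> H \<Longrightarrow> Y j \<notin> H \<Longrightarrow> F \<notin> H"
        "p' \<in> H \<Longrightarrow> q' \<in> H \<Longrightarrow> F \<in> H" "p' \<notin> H \<Longrightarrow> q' \<notin> H \<Longrightarrow> F \<notin> H"
        unfolding F_def F_iff[OF H order_refl] by fast+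
      then show "m (E i) (E j) F \<in> H \<longleftrightarrow> F \<in> H"
        using that by (simp add: halfspace_iff[OF H] E_def Y FP P) blast
    qed (use that in \<open>auto simp: EP FP\<close>)
    have "\<exists>i\<in>?I. E i = F"
    proof (rule ccontr)
      assume "\<not> (\<exists>i\<in>?I. E i = F)"
      then have "contains_cube P m (n + 1)"
        by (intro contains_cube_if_disjoint[of F q' _ "\<lambda>i. E (Suc i)"])
          (auto simp: FP P EP E_interval E_disjoint)
      then show False using rank unfolding median_rank_le_iff by fastforce
    qed
    then obtain i where i: "i \<in> ?I" "E i = F" by blast
    have "mdist (\<sigma> (E i)) (\<mu> (x i) p q) \<le> h + L * (h + D (length ps) + h)"
      unfolding E_def using i by (intro hom' near_Y near_F near_q Y FP P)
    then have "mdist p (\<mu> (x i) p q) \<le> R"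
      using near_F mdist_triangle[of p "\<mu> (x i) p q" "\<sigma> F"] i(2)
      unfolding R_def by (simp add: mdist_commute[of p])
    then show ?thesis using N i by blast
  qed
  then show "\<exists>N. \<forall>x p q. (\<forall>i\<in>?I. \<forall>j\<in>?I. i \<noteq> j \<longrightarrow> width p (\<mu> (x i) (x j) p) \<le> M) \<longrightarrow>
      (\<exists>i\<in>?I. width p (\<mu> (x i) p q) \<le> N)"
    by blast
qed


section \<open>Sequences up to bounded distance\<close>

definition mu_seq :: "(nat \<Rightarrow> 'a) \<Rightarrow> (nat \<Rightarrow> 'a) \<Rightarrow> (nat \<Rightarrow> 'a) \<Rightarrow> nat \<Rightarrow> 'a" where
  "mu_seq s t u = (\<lambda>k. \<mu> (s k) (t k) (u k))"

definition close_on :: "nat set \<Rightarrow> (nat \<Rightarrow> 'a) \<Rightarrow> (nat \<Rightarrow> 'a) \<Rightarrow> bool" where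
  "close_on I s t \<longleftrightarrow> (\<exists>C. \<forall>k\<in>I. mdist (s k) (t k) \<le> C)"

lemma close_on_refl [simp]: "close_on I s s"
  by (simp add: close_on_def)

lemma close_on_sym: "close_on I s t \<Longrightarrow> close_on I t s"
  by (simp add: close_on_def mdist_commute)

lemma close_on_trans:
  assumes "close_on I s t" "close_on I t u"
  shows "close_on I s u"
proof -
  obtain C C' where C: "\<And>k. k \<in> I \<Longrightarrow> mdist (s k) (t k) \<le> C" "\<And>k. k \<in> I \<Longrightarrow> mdist (t k) (u k) \<le> C'"
    using assms unfolding close_on_def by blast
  have "mdist (s k) (u k) \<le> C + C'" if "k \<in> I" for k
    using mdist_triangle[of "s k" "u k" "t k"] C(1)[OF that] C(2)[OF that] by linarith
  then show ?thesis unfolding close_on_def by blast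
qed

lemma close_on_mono: "\<lbrakk>close_on I s t; J \<subseteq> I\<rbrakk> \<Longrightarrow> close_on J s t"
  unfolding close_on_def by blast

lemma close_on_mu_seq:
  assumes "close_on I s s'" "close_on I t t'" "close_on I u u'"
  shows "close_on I (mu_seq s t u) (mu_seq s' t' u')"
proof -
  obtain L where L:
    "\<And>a a' b b' c c'. mdist (\<mu> a b c) (\<mu> a' b' c') \<le> L * (mdist a a' + mdist b b' + mdist c c')"
    using coarse_lipschitz by blast
  obtain A B C where C: "\<And>k. k \<in> I \<Longrightarrow> mdist (s k) (s' k) \<le> A"
    "\<And>k. k \<in> I \<Longrightarrow> mdist (t k) (t' k) \<le> B" "\<And>k. k \<in> I \<Longrightarrow> mdist (u k) (u' k) \<le> C"
    using assms unfolding close_on_def by blast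
  have "mdist (mu_seq s t u k) (mu_seq s' t' u' k) \<le> L * (A + B + C)" if k: "k \<in> I" for k
  proof -
    have "mdist (mu_seq s t u k) (mu_seq s' t' u' k)
        \<le> L * (mdist (s k) (s' k) + mdist (t k) (t' k) + mdist (u k) (u' k))"
      unfolding mu_seq_def by (rule L)
    also have "\<dots> \<le> L * (A + B + C)"
      using C k by (intro mult_le_mono2 add_mono) auto
    finally show ?thesis .
  qed
  then show ?thesis unfolding close_on_def by blast
qed

lemma close_on_distrib:
  "close_on I (mu_seq a b (mu_seq c d e)) (mu_seq (mu_seq a b c) (mu_seq a b d) e)"
proof -
  obtain K where
    K: "\<And>a b c d e. width (\<mu> a b (\<mu> c d e)) (\<mu> (\<mu> a b c) (\<mu> a b d) e) \<le> K"
    using coarse_distrib by blast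
  have "mdist (\<mu> a b (\<mu> c d e)) (\<mu> (\<mu> a b c) (\<mu> a b d) e) \<le> K" for a b c d e
    using K[of a b c d e] mdist_le_width[of "\<mu> a b (\<mu> c d e)" "\<mu> (\<mu> a b c) (\<mu> a b d) e"] by linarith
  then show ?thesis unfolding close_on_def mu_seq_def by blast
qed

lemma mu_seq_same: "mu_seq a a b = a"
  and mu_seq_swap23: "mu_seq a c b = mu_seq a b c"
  and mu_seq_swap12: "mu_seq b a c = mu_seq a b c"
  by (simp_all add: mu_seq_def mu_perm)

text \<open>
  The type of \<open>\<kappa>\<close> is arbitrary because two encodings of the quotient are used: by equivalence classes
  to show that it is finite, and then by natural numbers.
\<close>

definition quotient_op ::
    "(nat \<Rightarrow> 'a) set \<Rightarrow> ((nat \<Rightarrow> 'a) \<Rightarrow> 'c) \<Rightarrow> 'c \<Rightarrow> 'c \<Rightarrow> 'c \<Rightarrow> 'c" where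
  "quotient_op S \<kappa> x y z =
     \<kappa> (mu_seq (inv_into S \<kappa> x) (inv_into S \<kappa> y) (inv_into S \<kappa> z))"

context
  fixes S :: "(nat \<Rightarrow> 'a) set" and \<kappa> :: "(nat \<Rightarrow> 'a) \<Rightarrow> 'c" and I :: "nat set"
  assumes S: "\<And>s t u. \<lbrakk>s \<in> S; t \<in> S; u \<in> S\<rbrakk> \<Longrightarrow> mu_seq s t u \<in> S"
    and kernel: "\<And>s t. \<lbrakk>s \<in> S; t \<in> S\<rbrakk> \<Longrightarrow> \<kappa> s = \<kappa> t \<longleftrightarrow> close_on I s t"
begin

lemma close_on_representative: "s \<in> S \<Longrightarrow> close_on I (inv_into S \<kappa> (\<kappa> s)) s"
  by (metis f_inv_into_f image_eqI inv_into_into kernel)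

lemma quotient_op_class:
  assumes "s \<in> S" "t \<in> S" "u \<in> S"
  shows "quotient_op S \<kappa> (\<kappa> s) (\<kappa> t) (\<kappa> u) = \<kappa> (mu_seq s t u)"
proof -
  have "inv_into S \<kappa> (\<kappa> v) \<in> S" if "v \<in> S" for v
    using that by (intro inv_into_into) blast
  then show ?thesis
    unfolding quotient_op_def using assms
    by (subst kernel) (auto intro!: S close_on_mu_seq close_on_representative)
qed

lemma median_algebra_quotient: "median_algebra (\<kappa> ` S) (quotient_op S \<kappa>)"
  unfolding median_algebra_def
proof (intro conjI ballI; elim imageE; hypsubst)
  fix a b c d e
  show "a \<in> S \<Longrightarrow> b \<in> S \<Longrightarrow> c \<in> S \<Longrightarrow> d \<in> S \<Longrightarrow> e \<in> S \<Longrightarrow>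
    quotient_op S \<kappa> (\<kappa> a) (\<kappa> b) (quotient_op S \<kappa> (\<kappa> c) (\<kappa> d) (\<kappa> e)) =
    quotient_op S \<kappa> (quotient_op S \<kappa> (\<kappa> a) (\<kappa> b) (\<kappa> c)) (quotient_op S \<kappa> (\<kappa> a) (\<kappa> b) (\<kappa> d)) (\<kappa> e)"
    by (simp add: quotient_op_class S kernel close_on_distrib)
qed (simp_all add: quotient_op_class S mu_seq_same mu_seq_swap12 mu_seq_swap23)

end

definition class_on :: "nat set \<Rightarrow> (nat \<Rightarrow> 'a) \<Rightarrow> (nat \<Rightarrow> 'a) set" where
  "class_on I s = {t. close_on I s t}"

lemma class_on_eq_iff: "class_on I s = class_on I t \<longleftrightarrow> close_on I s t"
  unfolding class_on_def by (blast intro: close_on_refl close_on_sym close_on_trans)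

text \<open>
  The quotient is generated by the classes of the elements of \<open>G\<close>.
\<close>

lemma finitely_many_classes:
  assumes "finite G"
  shows "finite (class_on I ` generated mu_seq G)"
proof -
  let ?S = "generated mu_seq G" and ?\<kappa> = "class_on I"
  note cl = generated.step[of _ mu_seq G]
  note op = quotient_op_class[of ?S ?\<kappa> I, OF cl class_on_eq_iff]
  interpret median_alg "?\<kappa> ` ?S" "quotient_op ?S ?\<kappa>"
    using median_algebra_quotient[of ?S ?\<kappa> I, OF cl class_on_eq_iff] by unfold_locales
  have "?\<kappa> s \<in> generated (quotient_op ?S ?\<kappa>) (?\<kappa> ` G)" if "s \<in> ?S" for s
    using that
  proof induction
    case (step s t u)
    then show ?case
      using generated.step[OF step.IH] by (simp add: op)
  qed (auto intro: generated.base)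
  moreover have "x \<in> ?\<kappa> ` ?S" if "x \<in> generated (quotient_op ?S ?\<kappa>) (?\<kappa> ` G)" for x
    using that by induction (auto intro: generated.base)
  ultimately have "?\<kappa> ` ?S = generated (quotient_op ?S ?\<kappa>) (?\<kappa> ` G)" by blast
  then show ?thesis using assms by (intro finite_if_finitely_generated) auto
qed

text \<open>
  The class of a sequence on \<open>I\<close> determines its class on \<open>J\<close>, and the map between the finite sets
  of classes is not injective.
\<close>

lemma fewer_classes:
  assumes fin: "finite (class_on I ` S)" and J: "J \<subseteq> I"
    and st: "s \<in> S" "t \<in> S" "close_on J s t" "\<not> close_on I s t"
  shows "card (class_on J ` S) < card (class_on I ` S)"
proof -
  define g where "g X = (\<Union>t\<in>X. class_on J t)" for X
  have g: "g (class_on I s) = class_on J s" for s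
  proof -
    have "class_on J t = class_on J s" if "t \<in> class_on I s" for t
      using that close_on_mono[OF _ J] close_on_sym unfolding class_on_eq_iff
      by (auto simp: class_on_def)
    moreover have "s \<in> class_on I s" by (simp add: class_on_def)
    ultimately show ?thesis unfolding g_def by blast
  qed
  have eq: "class_on J ` S = g ` class_on I ` S" by (simp add: image_image g)
  have "\<not> inj_on g (class_on I ` S)"
  proof
    assume "inj_on g (class_on I ` S)"
    moreover have "g (class_on I s) = g (class_on I t)" using st(3) by (simp add: g class_on_eq_iff)
    ultimately have "class_on I s = class_on I t" using st(1,2) by (auto dest: inj_onD)
    then show False using st(4) by (simp add: class_on_eq_iff)
  qed
  then have "card (g ` class_on I ` S) \<noteq> card (class_on I ` S)"
    using fin eq_card_imp_inj_on by blast
  then show ?thesis unfolding eq using card_image_le[OF fin, of g] by linarith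
qed

section \<open>The rank of the algebra bounds the rank of the space\<close>

text \<open>
  Represent the origin of the cube by a sequence \<open>a\<close>, the opposite corner by \<open>b\<close> and the neighbours
  of the origin by sequences \<open>e i\<close>. The majority votes in the cube say that \<open>\<mu>\<close> of \<open>e i\<close>, \<open>e j\<close> and \<open>a\<close>
  is close to \<open>a\<close>, and that \<open>e i\<close> is close to \<open>\<mu>\<close> of \<open>e i\<close>, \<open>a\<close> and \<open>b\<close>. So the rank condition
  provides at each index some \<open>i\<close> for which \<open>e i\<close> is at bounded distance from \<open>a\<close>. The same \<open>i\<close>
  occurs infinitely often, and there \<open>a\<close> and \<open>e i\<close> are identified, which reduces the number of
  classes.
\<close>

lemma no_large_cube_if_fewest_classes:
  assumes rank: "algebra_rank_at_most \<mu> n" and I: "infinite I"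
    and S: "\<And>s t u. \<lbrakk>s \<in> S; t \<in> S; u \<in> S\<rbrakk> \<Longrightarrow> mu_seq s t u \<in> S"
    and fin: "finite (class_on I ` S)"
    and min: "\<And>J. infinite J \<Longrightarrow> card (class_on I ` S) \<le> card (class_on J ` S)"
    and kernel: "\<And>s t. \<lbrakk>s \<in> S; t \<in> S\<rbrakk> \<Longrightarrow> \<kappa> s = \<kappa> t \<longleftrightarrow> close_on I s t"
    and cube: "contains_cube (\<kappa> ` S) (quotient_op S \<kappa>) k"
  shows "k \<le> n"
proof (rule ccontr)
  assume "\<not> k \<le> n"
  then have k: "n < k" by simp
  let ?D = "{1..n+1}" and ?op = "quotient_op S \<kappa>"
  obtain T f where T: "T \<subseteq> \<kappa> ` S" and f: "bij_betw f (cube k) T"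
    and hom: "\<And>x y z. \<lbrakk>x \<in> cube k; y \<in> cube k; z \<in> cube k\<rbrakk> \<Longrightarrow>
      f (cube_majority k x y z) = ?op (f x) (f y) (f z)"
    using cube unfolding contains_cube_def by blast
  \<comment> \<open>the index shift matches the range \<open>{1..n+1}\<close> of the rank condition\<close>
  define \<delta> where "\<delta> i = (\<lambda>j\<in>{..<k}. Suc j = i)" for i
  define o0 where "o0 = (\<lambda>j\<in>{..<k}. False)"
  define o1 where "o1 = (\<lambda>j\<in>{..<k}. True)"
  have mem: "\<delta> i \<in> cube k" "o0 \<in> cube k" "o1 \<in> cube k" for i
    by (auto simp: \<delta>_def o0_def o1_def cube_def)
  have "\<exists>s. s \<in> S \<and> \<kappa> s = f x" if "x \<in> cube k" for x
    using that f T unfolding bij_betw_def by (metis image_iff subsetD)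
  then obtain r where r: "\<And>x. x \<in> cube k \<Longrightarrow> r x \<in> S \<and> \<kappa> (r x) = f x" by metis
  have op: "f (cube_majority k x y z) = \<kappa> (mu_seq (r x) (r y) (r z))"
    if "x \<in> cube k" "y \<in> cube k" "z \<in> cube k" for x y z
    using quotient_op_class[of S \<kappa> I, OF S kernel, of "r x" "r y" "r z"] hom[OF that] r that by simp
  define a where "a = r o0"
  define b where "b = r o1"
  define e where "e i = r (\<delta> i)" for i
  have inS: "a \<in> S" "b \<in> S" "e i \<in> S" for i using r mem by (auto simp: a_def b_def e_def)
  have orth: "close_on I a (mu_seq (e i) (e j) a)" if "i \<noteq> j" for i j
  proof -
    have "cube_majority k (\<delta> i) (\<delta> j) o0 = o0"
      using that by (auto simp: cube_majority_def \<delta>_def o0_def fun_eq_iff)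
    then have "\<kappa> a = \<kappa> (mu_seq (e i) (e j) a)"
      using op[of "\<delta> i" "\<delta> j" o0] r mem by (simp add: a_def e_def)
    then show ?thesis using inS by (simp add: kernel S)
  qed
  have betw: "close_on I (mu_seq (e i) a b) (e i)" for i
  proof -
    have "cube_majority k (\<delta> i) o0 o1 = \<delta> i"
      by (auto simp: cube_majority_def \<delta>_def o0_def o1_def fun_eq_iff)
    then have "\<kappa> (mu_seq (e i) a b) = \<kappa> (e i)"
      using op[of "\<delta> i" o0 o1] r mem by (simp add: a_def b_def e_def)
    then show ?thesis using inS by (simp add: kernel S)
  qed
  have nontrivial: "\<not> close_on I a (e i)" if i: "i \<in> ?D" for i
  proof
    assume "close_on I a (e i)"
    then have "f o0 = f (\<delta> i)" using inS r mem kernel by (metis a_def e_def)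
    then have "o0 = \<delta> i" using f mem unfolding bij_betw_def by (auto dest: inj_onD)
    moreover have "\<not> o0 (i - 1)" "\<delta> i (i - 1)" using i k by (auto simp: o0_def \<delta>_def)
    ultimately show False by simp
  qed
  have "\<exists>C. \<forall>i\<in>?D. \<forall>j\<in>?D. i \<noteq> j \<longrightarrow> (\<forall>l\<in>I. mdist (a l) (mu_seq (e i) (e j) a l) \<le> C)"
  proof -
    obtain c where c: "\<And>i j l. \<lbrakk>i \<noteq> j; l \<in> I\<rbrakk> \<Longrightarrow> mdist (a l) (mu_seq (e i) (e j) a l) \<le> c i j"
      using orth unfolding close_on_def by metis
    have "c i j \<le> (\<Sum>i\<in>?D. \<Sum>j\<in>?D. c i j)" if "i \<in> ?D" "j \<in> ?D" for i j
    proof -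
      have "c i j \<le> (\<Sum>j\<in>?D. c i j)" using that by (intro member_le_sum) auto
      also have "\<dots> \<le> (\<Sum>i\<in>?D. \<Sum>j\<in>?D. c i j)"
        using that by (intro member_le_sum[of i ?D "\<lambda>i. \<Sum>j\<in>?D. c i j"]) auto
      finally show ?thesis .
    qed
    then show ?thesis using c order_trans by meson
  qed
  then obtain C where C: "\<And>i j l. \<lbrakk>i \<in> ?D; j \<in> ?D; i \<noteq> j; l \<in> I\<rbrakk> \<Longrightarrow>
      mdist (a l) (mu_seq (e i) (e j) a l) \<le> C" by blast
  obtain M where M: "\<And>u v. mdist u v \<le> C \<Longrightarrow> width u v \<le> M"
    using width_le_if_mdist_le by blast
  from rank[unfolded algebra_rank_iff, THEN spec, of M]
  obtain N where N: "\<forall>x p q. (\<forall>i\<in>?D. \<forall>j\<in>?D. i \<noteq> j \<longrightarrow> width p (\<mu> (x i) (x j) p) \<le> M) \<longrightarrow>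
      (\<exists>i\<in>?D. width p (\<mu> (x i) p q) \<le> N)"
    by (elim exE)
  have "\<forall>l\<in>I. \<exists>i\<in>?D. width (a l) (mu_seq (e i) a b l) \<le> N"
  proof
    fix l assume "l \<in> I"
    then have "\<forall>i\<in>?D. \<forall>j\<in>?D. i \<noteq> j \<longrightarrow> width (a l) (\<mu> (e i l) (e j l) (a l)) \<le> M"
      using C M unfolding mu_seq_def by blast
    then show "\<exists>i\<in>?D. width (a l) (mu_seq (e i) a b l) \<le> N"
      using N[THEN spec, of "\<lambda>i. e i l", THEN spec, of "a l", THEN spec, of "b l"]
      unfolding mu_seq_def by (rule mp[rotated])
  qed
  then obtain i where i: "i \<in> ?D" and inf: "infinite {l \<in> I. width (a l) (mu_seq (e i) a b l) \<le> N}"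
    using pigeonhole_infinite_rel[OF I, of ?D "\<lambda>l i. width (a l) (mu_seq (e i) a b l) \<le> N"] by auto
  let ?J = "{l \<in> I. width (a l) (mu_seq (e i) a b l) \<le> N}"
  have "mdist (a l) (mu_seq (e i) a b l) \<le> N" if "l \<in> ?J" for l
    using that mdist_le_width[of "a l" "mu_seq (e i) a b l"] unfolding mem_Collect_eq by linarith
  then have "close_on ?J a (mu_seq (e i) a b)" unfolding close_on_def by blast
  then have "close_on ?J a (e i)"
    using close_on_trans close_on_mono[OF betw[of i], of ?J] by blast
  then have "card (class_on ?J ` S) < card (class_on I ` S)"
    using nontrivial[OF i] inS by (intro fewer_classes[OF fin, of ?J a "e i"]) auto
  then show False using min[OF inf] by simp
qed

text \<open>
  A counterexample \<open>A h\<close> to every error \<open>h\<close> is approximated, for suitable \<open>h\<close>, by one finite median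
  algebra of classes of sequences.
\<close>

lemma algebra_rank_imp_space_rank:
  assumes rank: "algebra_rank_at_most \<mu> n"
  shows "space_rank_at_most (induced_metric \<mu>) \<mu> n"
  unfolding space_rank_iff
proof (rule allI, rule ccontr)
  fix p
  assume "\<not> (\<exists>h. \<forall>A. finite A \<and> 1 \<le> card A \<and> card A \<le> p \<longrightarrow> approximable n h A)"
  then obtain A where A: "\<And>h. finite (A h)" "\<And>h. 1 \<le> card (A h)" "\<And>h. card (A h) \<le> p"
    "\<And>h. \<not> approximable n h (A h)" by metis
  have "\<exists>v. v ` {..<p} = A h" for h
  proof -
    obtain w where w: "bij_betw w {..<card (A h)} (A h)"
      using ex_bij_betw_nat_finite[OF A(1)] by (auto simp: atLeast0LessThan)
    \<comment> \<open>repeat the last point to fill up all \<open>p\<close> places\<close>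
    let ?v = "\<lambda>i. w (min i (card (A h) - 1))"
    have "?v ` {..<p} = w ` {..<card (A h)}"
    proof
      show "?v ` {..<p} \<subseteq> w ` {..<card (A h)}" using A(2)[of h] by auto
      show "w ` {..<card (A h)} \<subseteq> ?v ` {..<p}"
      proof
        fix y assume "y \<in> w ` {..<card (A h)}"
        then obtain i where "i < card (A h)" "y = w i" by auto
        then show "y \<in> ?v ` {..<p}" using A(3)[of h] by (intro image_eqI[of _ _ i]) auto
      qed
    qed
    then show ?thesis using w by (metis bij_betw_imp_surj_on)
  qed
  then obtain v where v: "\<And>h. v h ` {..<p} = A h" by metis
  define g where "g i = (\<lambda>h. v h i)" for i
  define S where "S = generated mu_seq (g ` {..<p})"
  have gS: "g i \<in> S" if "i < p" for i using that by (auto simp: S_def intro: generated.base)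
  have S: "mu_seq s t u \<in> S" if "s \<in> S" "t \<in> S" "u \<in> S" for s t u
    using that unfolding S_def by (rule generated.step)
  obtain I where I: "infinite I"
    and min: "\<And>J. infinite J \<Longrightarrow> card (class_on I ` S) \<le> card (class_on J ` S)"
    using ex_has_least_nat[of "infinite :: nat set \<Rightarrow> bool" UNIV "\<lambda>I. card (class_on I ` S)"]
    by auto
  have fin: "finite (class_on I ` S)" unfolding S_def by (rule finitely_many_classes) simp
  obtain \<iota> :: "(nat \<Rightarrow> 'a) set \<Rightarrow> nat" where \<iota>: "inj_on \<iota> (class_on I ` S)"
    using finite_imp_inj_to_nat_seg[OF fin] by blast
  define \<kappa> where "\<kappa> s = \<iota> (class_on I s)" for s
  have kernel: "\<kappa> s = \<kappa> t \<longleftrightarrow> close_on I s t" if "s \<in> S" "t \<in> S" for s t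
    using that \<iota> unfolding \<kappa>_def class_on_eq_iff[symmetric] by (auto dest: inj_onD)
  let ?P = "\<kappa> ` S" and ?op = "quotient_op S \<kappa>"
  have finP: "finite ?P"
    using fin finite_imageI[of "class_on I ` S" \<iota>] by (simp add: \<kappa>_def image_image)
  have malg: "median_algebra ?P ?op"
    by (rule median_algebra_quotient[of S \<kappa> I]) (simp_all add: S kernel)
  interpret median_alg ?P ?op using malg by unfold_locales
  have rankP: "median_rank ?P ?op \<le> enat n"
    unfolding median_rank_le_iff
    using no_large_cube_if_fewest_classes[OF rank I S fin min, of \<kappa>] kernel by blast
  define rep where "rep = inv_into S \<kappa>"
  have repS: "rep x \<in> S" if "x \<in> ?P" for x
    using that unfolding rep_def by (rule inv_into_into)
  have rep: "close_on I (rep (\<kappa> s)) s" if "s \<in> S" for s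
    unfolding rep_def using that by (intro close_on_representative) (simp_all add: S kernel)
  have "\<exists>C. \<forall>h\<in>I. mdist (rep (?op x y z) h) (\<mu> (rep x h) (rep y h) (rep z h)) \<le> C"
    if "x \<in> ?P" "y \<in> ?P" "z \<in> ?P" for x y z
    using rep[OF S[OF repS repS repS, OF that]]
    unfolding close_on_def quotient_op_def rep_def[symmetric] by (simp add: mu_seq_def)
  then obtain C where C: "\<And>x y z h. \<lbrakk>x \<in> ?P; y \<in> ?P; z \<in> ?P; h \<in> I\<rbrakk> \<Longrightarrow>
      mdist (rep (?op x y z) h) (\<mu> (rep x h) (rep y h) (rep z h)) \<le> C x y z" by metis
  have "\<exists>C. \<forall>h\<in>I. mdist (g i h) (rep (\<kappa> (g i)) h) \<le> C" if "i < p" for i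
    using close_on_sym[OF rep[OF gS[OF that]]] unfolding close_on_def .
  then obtain C' where C': "\<And>i h. \<lbrakk>i < p; h \<in> I\<rbrakk> \<Longrightarrow> mdist (g i h) (rep (\<kappa> (g i)) h) \<le> C' i"
    by metis
  \<comment> \<open>finitely many bounds that hold on \<open>I\<close> have a common bound\<close>
  define b where "b = (\<Sum>(x, y, z)\<in>?P \<times> ?P \<times> ?P. C x y z) + (\<Sum>i<p. C' i)"
  have C_le: "C x y z \<le> b" if "x \<in> ?P" "y \<in> ?P" "z \<in> ?P" for x y z
  proof -
    have "C x y z \<le> (\<Sum>(x, y, z)\<in>?P \<times> ?P \<times> ?P. C x y z)"
      using member_le_sum[of "(x, y, z)" "?P \<times> ?P \<times> ?P" "\<lambda>(x, y, z). C x y z"] that finP by auto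
    then show ?thesis by (simp add: b_def)
  qed
  have C'_le: "C' i \<le> b" if "i < p" for i
    using member_le_sum[of i "{..<p}" C'] that by (auto simp: b_def)
  obtain h where h: "h \<in> I" "b \<le> h"
    using I by (meson infinite_nat_iff_unbounded_le)
  define idx where "idx x = (SOME i. i < p \<and> g i h = x)" for x
  have idx: "idx x < p \<and> g (idx x) h = x" if "x \<in> A h" for x
  proof -
    have "x \<in> v h ` {..<p}" using that by (simp add: v)
    then have "\<exists>i. i < p \<and> g i h = x" unfolding g_def by blast
    then show ?thesis unfolding idx_def by (rule someI_ex)
  qed
  have "approximable n h (A h)"
    unfolding approximable_def
  proof (intro exI[of _ ?P] exI[of _ ?op] exI[of _ "\<lambda>x. \<kappa> (g (idx x))"] exI[of _ "\<lambda>x. rep x h"] conjI ballI)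
    show "(\<lambda>x. \<kappa> (g (idx x))) \<in> A h \<rightarrow> ?P" using idx gS by blast
    show "mdist (rep (?op x y z) h) (\<mu> (rep x h) (rep y h) (rep z h)) \<le> h"
      if "x \<in> ?P" "y \<in> ?P" "z \<in> ?P" for x y z
      using C[OF that h(1)] C_le[OF that] h(2) by linarith
    show "mdist a (rep (\<kappa> (g (idx a))) h) \<le> h" if "a \<in> A h" for a
      using C'[of "idx a" h] C'_le[of "idx a"] idx[OF that] h by fastforce
  qed (use finP malg rankP in auto)
  then show False using A(4) by blast
qed

end

theorem lemma6p9:
  fixes \<mu> :: "'a \<Rightarrow> 'a \<Rightarrow> 'a \<Rightarrow> 'a" and n :: nat
  assumes "coarse_median_algebra \<mu>" and "bounded_valency \<mu>"
  shows "algebra_rank_at_most \<mu> n \<longleftrightarrow> space_rank_at_most (induced_metric \<mu>) \<mu> n"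
proof -
  interpret bounded_valency_algebra \<mu> using assms by unfold_locales
  show ?thesis
    using algebra_rank_imp_space_rank space_rank_imp_algebra_rank by blast
qed

end
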